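(* Let $(X,\sigma)$ be a Toeplitz subshift with period structure $(p_n)$. Then the stabilized automorphism group $\operatorname{Aut}^{(\infty)}(X,\sigma)$ is isomorphic to the direct limit of a sequence of group monomorphisms $G_0\to G_1\to G_2\to\cdots$ in which each group $G_j$ is of the form $\operatorname{Aut}(T,\tau)^{p_k}\rtimes\operatorname{Sym}(p_k)$, where $(T,\tau)$ is a Toeplitz subshift and $p_k$ is a term of the sequence $(p_n)$.
   Context: Let $\mathcal{A}$ be a finite alphabet and $\sigma$ the left shift on $\mathcal{A}^{\mathbb{Z}}$, $(\sigma x)_i=x_{i+1}$. A sequence $u\in\mathcal{A}^{\mathbb{Z}}$ is a Toeplitz sequence if for every $n\in\mathbb{Z}$ there is $m\ge1$ with $u_n=u_{n+km}$ for all $k\in\mathbb{Z}$; it is assumed non-periodic. For $p\ge1$ let $\operatorname{per}_p(u)=\{k : u_k=u_{k+pm}\ \forall m\in\mathbb{Z}\}$. A period structure of $u$ is a sequence $(p_n)$ with $p_n\mid p_{n+1}$, $\bigcup_n\operatorname{per}_{p_n}(u)=\mathbb{Z}$, and each $p_n$ essential (for $1\le p<p_n$, $\operatorname{per}_p(u)\ne\operatorname{per}_{p_n}(u)$). The Toeplitz subshift given by $u$ is $(X,\sigma)$ with $X$ the closure of the $\sigma$-orbit of $u$. For a homeomorphism $T$ of a compact metric space $X$, $\operatorname{Aut}(X,T)$ is the group of homeomorphisms commuting with $T$ and $\operatorname{Aut}^{(\infty)}(X,T)=\bigcup_{n\ge1}\operatorname{Aut}(X,T^n)\subseteq\operatorname{Homeo}(X)$.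 $\operatorname{Sym}(n)$ is the symmetric group, acting on $H^n$ by permuting coordinates in $H^n\rtimes\operatorname{Sym}(n)$. *)

theory Defs
  imports "HOL-Analysis.Analysis" "HOL-Algebra.Group"
begin

definition shift :: "(int \<Rightarrow> 'a) \<Rightarrow> (int \<Rightarrow> 'a)" where
  "shift x = (\<lambda>i. x (i + 1))"

definition full_shift_top :: "(int \<Rightarrow> 'a) topology" where
  "full_shift_top = product_topology (\<lambda>_. discrete_topology UNIV) UNIV"

definition orbit :: "(int \<Rightarrow> 'a) \<Rightarrow> (int \<Rightarrow> 'a) set" where
  "orbit u = {(\<lambda>i. u (i + n)) | n :: int. True}"

definition subshift :: "(int \<Rightarrow> 'a) \<Rightarrow> (int \<Rightarrow> 'a) set" where
  "subshift u = full_shift_top closure_of (orbit u)"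

definition subshift_top :: "(int \<Rightarrow> 'a) \<Rightarrow> (int \<Rightarrow> 'a) topology" where
  "subshift_top u = subtopology full_shift_top (subshift u)"

definition periodic_seq :: "(int \<Rightarrow> 'a) \<Rightarrow> bool" where
  "periodic_seq u \<longleftrightarrow> (\<exists>q::int. q \<ge> 1 \<and> (\<forall>i. u (i + q) = u i))"

definition toeplitz :: "(int \<Rightarrow> 'a) \<Rightarrow> bool" where
  "toeplitz u \<longleftrightarrow> \<not> periodic_seq u \<and>
     (\<forall>n. \<exists>m::int. m \<ge> 1 \<and> (\<forall>k. u n = u (n + k * m)))"

definition per :: "(int \<Rightarrow> 'a) \<Rightarrow> nat \<Rightarrow> int set" where
  "per u p = {k. \<forall>m::int. u k = u (k + int p * m)}"

definition essential_period :: "(int \<Rightarrow> 'a) \<Rightarrow> nat \<Rightarrow> bool" where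
  "essential_period u p \<longleftrightarrow> (\<forall>q. 1 \<le> q \<and> q < p \<longrightarrow> per u q \<noteq> per u p)"

definition period_structure :: "(int \<Rightarrow> 'a) \<Rightarrow> (nat \<Rightarrow> nat) \<Rightarrow> bool" where
  "period_structure u p \<longleftrightarrow>
     (\<forall>n. p n \<ge> 1 \<and> p n dvd p (Suc n) \<and> essential_period u (p n)) \<and>
     (\<Union>n. per u (p n)) = UNIV"

definition aut_group :: "'x topology \<Rightarrow> ('x \<Rightarrow> 'x) \<Rightarrow> ('x \<Rightarrow> 'x) monoid" where
  "aut_group Top S =
    \<lparr>carrier = {f. homeomorphic_map Top Top f \<and> f \<in> extensional (topspace Top) \<and>
                   (\<forall>x\<in>topspace Top. f (S x) = S (f x))},
     mult = (\<lambda>f g. compose (topspace Top) f g),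
     one = restrict id (topspace Top)\<rparr>"

definition stab_aut_group :: "'x topology \<Rightarrow> ('x \<Rightarrow> 'x) \<Rightarrow> ('x \<Rightarrow> 'x) monoid" where
  "stab_aut_group Top S =
    \<lparr>carrier = (\<Union>n\<in>{1..}. carrier (aut_group Top (S ^^ n))),
     mult = (\<lambda>f g. compose (topspace Top) f g),
     one = restrict id (topspace Top)\<rparr>"

definition aut_subshift :: "(int \<Rightarrow> 'a) \<Rightarrow> ((int \<Rightarrow> 'a) \<Rightarrow> (int \<Rightarrow> 'a)) monoid" where
  "aut_subshift u = aut_group (subshift_top u) shift"

definition stab_aut_subshift :: "(int \<Rightarrow> 'a) \<Rightarrow> ((int \<Rightarrow> 'a) \<Rightarrow> (int \<Rightarrow> 'a)) monoid" where
  "stab_aut_subshift u = stab_aut_group (subshift_top u) shift"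

text \<open>Elements (f, pi) with f : {0..<n} -> H and pi a permutation of {0..<n};
  Sym(n) acts on H^n by permuting coordinates, (pi . g) i = g (pi^-1 i), and
  (f,pi)(g,rho) = (f * (pi . g), pi o rho).\<close>
definition power_rtimes_sym :: "('b, 'm) monoid_scheme \<Rightarrow> nat \<Rightarrow> ((nat \<Rightarrow> 'b) \<times> (nat \<Rightarrow> nat)) monoid" where
  "power_rtimes_sym H n =
    \<lparr>carrier = {(f, \<pi>). f \<in> {0..<n} \<rightarrow>\<^sub>E carrier H \<and> \<pi> permutes {0..<n}},
     mult = (\<lambda>(f, \<pi>) (g, \<rho>). ((\<lambda>i\<in>{0..<n}. f i \<otimes>\<^bsub>H\<^esub> g (inv_into UNIV \<pi> i)), \<pi> \<circ> \<rho>)),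
     one = ((\<lambda>i\<in>{0..<n}. \<one>\<^bsub>H\<^esub>), id)\<rparr>"

primrec connect :: "(nat \<Rightarrow> 'g \<Rightarrow> 'g) \<Rightarrow> nat \<Rightarrow> nat \<Rightarrow> 'g \<Rightarrow> 'g" where
  "connect \<phi> i 0 g = g"
| "connect \<phi> i (Suc d) g = \<phi> (i + d) (connect \<phi> i d g)"

definition connect_to :: "(nat \<Rightarrow> 'g \<Rightarrow> 'g) \<Rightarrow> nat \<Rightarrow> nat \<Rightarrow> 'g \<Rightarrow> 'g" where
  "connect_to \<phi> i k = connect \<phi> i (k - i)"

definition dirlim_rel :: "(nat \<Rightarrow> ('g, 'm) monoid_scheme) \<Rightarrow> (nat \<Rightarrow> 'g \<Rightarrow> 'g) \<Rightarrow> ((nat \<times> 'g) \<times> (nat \<times> 'g)) set" where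
  "dirlim_rel G \<phi> = {((i, g), (j, h)). g \<in> carrier (G i) \<and> h \<in> carrier (G j) \<and>
      (\<exists>k\<ge>max i j. connect_to \<phi> i k g = connect_to \<phi> j k h)}"

definition dirlim :: "(nat \<Rightarrow> ('g, 'm) monoid_scheme) \<Rightarrow> (nat \<Rightarrow> 'g \<Rightarrow> 'g) \<Rightarrow> ((nat \<times> 'g) set) monoid" where
  "dirlim G \<phi> =
    \<lparr>carrier = (SIGMA i:UNIV. carrier (G i)) // dirlim_rel G \<phi>,
     mult = (\<lambda>A B. let (i, g) = (SOME a. a \<in> A); (j, h) = (SOME b. b \<in> B); m = max i j
                    in dirlim_rel G \<phi> `` {(m, connect_to \<phi> i m g \<otimes>\<^bsub>G m\<^esub> connect_to \<phi> j m h)}),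
     one = dirlim_rel G \<phi> `` {(0, \<one>\<^bsub>G 0\<^esub>)}\<rparr>"

end

theory Submission
  imports Defs "HOL-Number_Theory.Cong"
begin

text \<open>
  For \<open>q = p k\<close>, essentiality of \<open>q\<close> splits the subshift \<open>X\<close> of \<open>u\<close> into \<open>q\<close> clopen \<open>\<sigma>^q\<close>-minimal components that \<open>\<sigma>\<close>
  permutes cyclically, and coding \<open>u\<close> in blocks of length \<open>q\<close> makes each of them conjugate to a Toeplitz subshift.
  An element of \<open>Aut(X, \<sigma>^q)\<close> permutes the components, so this group is \<open>Aut(T, \<tau>)^q \<rtimes> Sym(q)\<close>. These groups
  increase with \<open>k\<close>. They exhaust the stabilized group: a map \<open>f\<close> commuting with \<open>\<sigma>^n\<close> acts on the odometer
  \<open>lim Z/(p k)\<close> by translations on the components of \<open>\<sigma>^n\<close>, hence commutes there with the translation by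
  \<open>d = gcd n (p k)\<close>, \<open>k\<close> large. Since \<open>X\<close> is an almost one-to-one extension of the odometer, \<open>f\<close> commutes with \<open>\<sigma>^d\<close>.
\<close>

section \<open>Direct limits of exhausting sequences\<close>

text \<open>The odometer is never built: a residue class \<open>i\<close> modulo \<open>q\<close> is
  represented by the closed set \<open>cell u q i\<close>, and approximation is agreement on finite
  windows. The difficulty is that \<open>n\<close> may contain prime powers dividing no
  \<open>p k\<close>. As \<open>gcd n (p l)\<close> grows under divisibility but divides
  \<open>n\<close>, it stabilizes at some \<open>d\<close>, and the powers of
  \<open>\<sigma>^n\<close> then approximate those of \<open>\<sigma>^d\<close>. Commutation must
  still be lifted from residue classes to points, where the projection is not injective; this works
  because fibres over the orbit of \<open>u\<close> are single points and \<open>f\<close> is onto,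
  so \<open>f\<close> takes such a value in every relevant component. The connecting monomorphisms
  have no closed formula here. Each group is embedded in the stabilized group, the images increase,
  and the maps are the inclusions read through the embeddings.\<close>

lemma connect_comm:
  assumes step: "\<And>j g. g \<in> carrier (G j) \<Longrightarrow> \<phi> j g \<in> carrier (G (Suc j)) \<and> \<psi> (Suc j) (\<phi> j g) = \<psi> j g"
    and "g \<in> carrier (G i)"
  shows "connect \<phi> i d g \<in> carrier (G (i + d)) \<and> \<psi> (i + d) (connect \<phi> i d g) = \<psi> i g"
  using assms(2) by (induction d) (auto simp: step)

text \<open>The maps \<open>\<psi> j\<close> have a common target and \<open>\<phi>\<close> respects
  them, so an element keeps its image while it moves along the sequence. Two elements with the same
  image meet at stage \<open>max i j\<close>, because \<open>\<psi>\<close> is injective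
  there.\<close>

lemma dirlim_rel_eq:
  assumes step: "\<And>j g. g \<in> carrier (G j) \<Longrightarrow> \<phi> j g \<in> carrier (G (Suc j)) \<and> \<psi> (Suc j) (\<phi> j g) = \<psi> j g"
    and inj: "\<And>j. inj_on (\<psi> j) (carrier (G j))"
  shows "dirlim_rel G \<phi> = {((i, g), (j, h)). g \<in> carrier (G i) \<and> h \<in> carrier (G j) \<and> \<psi> i g = \<psi> j h}"
proof -
  have to: "connect_to \<phi> i k g \<in> carrier (G k) \<and> \<psi> k (connect_to \<phi> i k g) = \<psi> i g"
    if "g \<in> carrier (G i)" "i \<le> k" for i k g
    using connect_comm[of G \<phi> \<psi> g i "k - i"] step that by (auto simp: connect_to_def)
  have "(\<exists>k\<ge>max i j. connect_to \<phi> i k g = connect_to \<phi> j k h) \<longleftrightarrow> \<psi> i g = \<psi> j h"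
    if *: "g \<in> carrier (G i)" "h \<in> carrier (G j)" for i g j h
  proof
    assume "\<exists>k\<ge>max i j. connect_to \<phi> i k g = connect_to \<phi> j k h"
    then obtain k where "i \<le> k" "j \<le> k" "connect_to \<phi> i k g = connect_to \<phi> j k h" by auto
    then show "\<psi> i g = \<psi> j h" using to[OF *(1)] to[OF *(2)] by metis
  next
    assume "\<psi> i g = \<psi> j h"
    then have "connect_to \<phi> i (max i j) g = connect_to \<phi> j (max i j) h"
      using to[OF *(1), of "max i j"] to[OF *(2), of "max i j"] inj[of "max i j"]
      by (auto simp: inj_on_def)
    then show "\<exists>k\<ge>max i j. connect_to \<phi> i k g = connect_to \<phi> j k h" by blast
  qed
  then show ?thesis unfolding dirlim_rel_def by blast
qed

text \<open>A class of the limit is a fibre, the set of all \<open>(j, g)\<close> with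
  \<open>\<psi> j g = s\<close>. Sending \<open>s\<close> to its fibre needs no choice of
  representatives.\<close>

lemma iso_dirlim:
  assumes closed: "\<And>j g h. g \<in> carrier (G j) \<Longrightarrow> h \<in> carrier (G j) \<Longrightarrow> g \<otimes>\<^bsub>G j\<^esub> h \<in> carrier (G j)"
    and hom: "\<And>j. \<psi> j \<in> hom (G j) S"
    and inj: "\<And>j. inj_on (\<psi> j) (carrier (G j))"
    and cover: "carrier S = (\<Union>j. \<psi> j ` carrier (G j))"
    and step: "\<And>j g. g \<in> carrier (G j) \<Longrightarrow> \<phi> j g \<in> carrier (G (Suc j)) \<and> \<psi> (Suc j) (\<phi> j g) = \<psi> j g"
  shows "S \<cong> dirlim G \<phi>"
proof -
  define cls where "cls s = {(j, g). g \<in> carrier (G j) \<and> \<psi> j g = s}" for s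
  have rel: "dirlim_rel G \<phi> =
      {((i, g), (j, h)). g \<in> carrier (G i) \<and> h \<in> carrier (G j) \<and> \<psi> i g = \<psi> j h}"
    using step inj by (rule dirlim_rel_eq)
  have to: "connect_to \<phi> i k g \<in> carrier (G k) \<and> \<psi> k (connect_to \<phi> i k g) = \<psi> i g"
    if "g \<in> carrier (G i)" "i \<le> k" for i k g
    using connect_comm[of G \<phi> \<psi> g i "k - i"] step that by (auto simp: connect_to_def)
  have cls: "dirlim_rel G \<phi> `` {(j, g)} = cls (\<psi> j g)" if "g \<in> carrier (G j)" for j g
    using that unfolding rel cls_def by auto
  have nonempty: "cls s \<noteq> {}" if "s \<in> carrier S" for s
    using that unfolding cover cls_def by auto
  have mult: "cls s \<otimes>\<^bsub>dirlim G \<phi>\<^esub> cls s' = cls (s \<otimes>\<^bsub>S\<^esub> s')"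
    if s: "s \<in> carrier S" and s': "s' \<in> carrier S" for s s'
  proof -
    \<comment> \<open>The product in \<open>dirlim\<close> picks representatives by
      \<open>SOME\<close>; whichever pairs these are, they lie over \<open>s\<close> and
      \<open>s'\<close>, and this determines the class of the product.\<close>
    obtain i g where ig: "(SOME a. a \<in> cls s) = (i, g)" by (meson surj_pair)
    obtain j h where jh: "(SOME a. a \<in> cls s') = (j, h)" by (meson surj_pair)
    have "(i, g) \<in> cls s" "(j, h) \<in> cls s'"
      using nonempty[OF s] nonempty[OF s'] ig jh by (metis some_in_eq)+
    then have g: "g \<in> carrier (G i)" "\<psi> i g = s" and h: "h \<in> carrier (G j)" "\<psi> j h = s'"
      by (auto simp: cls_def)
    define m where "m = max i j"
    note g' = to[OF g(1), of m] and h' = to[OF h(1), of m]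
    have "cls s \<otimes>\<^bsub>dirlim G \<phi>\<^esub> cls s' =
        dirlim_rel G \<phi> `` {(m, connect_to \<phi> i m g \<otimes>\<^bsub>G m\<^esub> connect_to \<phi> j m h)}"
      by (simp add: dirlim_def ig jh m_def Let_def)
    also have "\<dots> = cls (\<psi> m (connect_to \<phi> i m g \<otimes>\<^bsub>G m\<^esub> connect_to \<phi> j m h))"
      using g' h' closed by (intro cls) (auto simp: m_def)
    also have "\<dots> = cls (s \<otimes>\<^bsub>S\<^esub> s')"
      using g' h' g h hom_mult[OF hom] by (auto simp: m_def)
    finally show ?thesis .
  qed
  have carr: "carrier (dirlim G \<phi>) = cls ` carrier S"
    unfolding dirlim_def cover quotient_def using cls by force
  have "cls \<in> iso S (dirlim G \<phi>)"
  proof (rule isoI)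
    show "cls \<in> hom S (dirlim G \<phi>)"
      by (rule homI) (auto simp: carr mult)
    have "inj_on cls (carrier S)"
    proof (rule inj_onI)
      fix s s' assume "s \<in> carrier S" "s' \<in> carrier S" "cls s = cls s'"
      then show "s = s'" using nonempty[of s] by (auto simp: cls_def)
    qed
    then show "bij_betw cls (carrier S) (carrier (dirlim G \<phi>))"
      by (simp add: carr bij_betw_def)
  qed
  then show ?thesis by (auto simp: is_iso_def)
qed

text \<open>The images in \<open>S\<close> form an increasing chain, and the connecting map is the
  inclusion of one image in the next, pulled back along the injection \<open>\<psi> (Suc j)\<close>.
  Multiplicativity can be tested after applying that injection.\<close>

lemma iso_dirlim_exhaustion:
  assumes closed: "\<And>j g h. g \<in> carrier (G j) \<Longrightarrow> h \<in> carrier (G j) \<Longrightarrow> g \<otimes>\<^bsub>G j\<^esub> h \<in> carrier (G j)"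
    and hom: "\<And>j. \<psi> j \<in> hom (G j) S"
    and inj: "\<And>j. inj_on (\<psi> j) (carrier (G j))"
    and mono: "\<And>j. \<psi> j ` carrier (G j) \<subseteq> \<psi> (Suc j) ` carrier (G (Suc j))"
    and cover: "carrier S = (\<Union>j. \<psi> j ` carrier (G j))"
  shows "\<exists>\<phi>. (\<forall>j. \<phi> j \<in> hom (G j) (G (Suc j)) \<and> inj_on (\<phi> j) (carrier (G j))) \<and> S \<cong> dirlim G \<phi>"
proof -
  define \<phi> where "\<phi> j g = inv_into (carrier (G (Suc j))) (\<psi> (Suc j)) (\<psi> j g)" for j g
  have step: "\<phi> j g \<in> carrier (G (Suc j)) \<and> \<psi> (Suc j) (\<phi> j g) = \<psi> j g" if "g \<in> carrier (G j)" for j g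
  proof -
    have "\<psi> j g \<in> \<psi> (Suc j) ` carrier (G (Suc j))" using mono[of j] that by blast
    then show ?thesis unfolding \<phi>_def by (simp add: inv_into_into f_inv_into_f)
  qed
  have "\<phi> j \<in> hom (G j) (G (Suc j))" for j
  proof (rule homI)
    fix g h assume gh: "g \<in> carrier (G j)" "h \<in> carrier (G j)"
    show "\<phi> j (g \<otimes>\<^bsub>G j\<^esub> h) = \<phi> j g \<otimes>\<^bsub>G (Suc j)\<^esub> \<phi> j h"
    proof (rule inj_onD[OF inj[of "Suc j"]])
      show "\<psi> (Suc j) (\<phi> j (g \<otimes>\<^bsub>G j\<^esub> h)) = \<psi> (Suc j) (\<phi> j g \<otimes>\<^bsub>G (Suc j)\<^esub> \<phi> j h)"
        using gh step closed by (simp add: hom_mult[OF hom])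
    qed (use gh step closed in auto)
  qed (use step in blast)
  moreover have "inj_on (\<phi> j) (carrier (G j))" for j
  proof (rule inj_onI)
    fix g h assume gh: "g \<in> carrier (G j)" "h \<in> carrier (G j)" and "\<phi> j g = \<phi> j h"
    then have "\<psi> j g = \<psi> j h" using step by metis
    then show "g = h" using inj_onD[OF inj] gh by blast
  qed
  ultimately show ?thesis
    using iso_dirlim[of G \<psi> S \<phi>, OF closed hom inj cover step] by blast
qed

section \<open>Automorphism groups of towers\<close>

lemma aut_groupI:
  assumes "homeomorphic_maps Top Top f g" "f \<in> extensional (topspace Top)"
    "\<And>x. x \<in> topspace Top \<Longrightarrow> f (S x) = S (f x)"
  shows "f \<in> carrier (aut_group Top S)"
  using assms by (auto simp: aut_group_def homeomorphic_map_maps)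

lemma aut_groupE:
  assumes "f \<in> carrier (aut_group Top S)" "S \<in> topspace Top \<rightarrow> topspace Top"
  obtains g where "homeomorphic_maps Top Top f g" "f \<in> extensional (topspace Top)"
    "\<And>x. x \<in> topspace Top \<Longrightarrow> f (S x) = S (f x)"
    "\<And>x. x \<in> topspace Top \<Longrightarrow> g (S x) = S (g x)"
proof -
  obtain g where g: "homeomorphic_maps Top Top f g" and f: "f \<in> extensional (topspace Top)"
    "\<And>x. x \<in> topspace Top \<Longrightarrow> f (S x) = S (f x)"
    using assms(1) by (auto simp: aut_group_def homeomorphic_map_maps)
  have gX: "g x \<in> topspace Top" if "x \<in> topspace Top" for x
    using g that by (auto simp: homeomorphic_maps_def continuous_map_def)
  have "g (S x) = S (g x)" if x: "x \<in> topspace Top" for x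
  proof -
    have "S x = f (S (g x))" using f(2)[OF gX[OF x]] g x by (auto simp: homeomorphic_maps_def)
    moreover have "S (g x) \<in> topspace Top" using gX[OF x] assms(2) by auto
    ultimately show ?thesis using g by (metis homeomorphic_maps_def)
  qed
  with g f that show thesis by blast
qed

lemma aut_group_mult_closed:
  assumes "f \<in> carrier (aut_group Top S)" "g \<in> carrier (aut_group Top S)"
    "S \<in> topspace Top \<rightarrow> topspace Top"
  shows "f \<otimes>\<^bsub>aut_group Top S\<^esub> g \<in> carrier (aut_group Top S)"
proof -
  have f: "homeomorphic_map Top Top f" "\<And>x. x \<in> topspace Top \<Longrightarrow> f (S x) = S (f x)"
   and g: "homeomorphic_map Top Top g" "\<And>x. x \<in> topspace Top \<Longrightarrow> g (S x) = S (g x)"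
    using assms by (auto simp: aut_group_def)
  have gX: "g x \<in> topspace Top" if "x \<in> topspace Top" for x
    using homeomorphic_imp_surjective_map[OF g(1)] that by auto
  have "homeomorphic_map Top Top (compose (topspace Top) f g)"
    by (rule homeomorphic_map_eq[OF homeomorphic_map_compose[OF g(1) f(1)]]) (simp add: compose_eq)
  moreover have "compose (topspace Top) f g (S x) = S (compose (topspace Top) f g x)"
    if "x \<in> topspace Top" for x
    using that gX f g assms(3) by (simp add: compose_eq Pi_iff)
  ultimately show ?thesis by (simp add: aut_group_def)
qed

lemma power_rtimes_sym_mult_closed:
  assumes H: "\<And>a b. a \<in> carrier H \<Longrightarrow> b \<in> carrier H \<Longrightarrow> a \<otimes>\<^bsub>H\<^esub> b \<in> carrier H"
    and "x \<in> carrier (power_rtimes_sym H n)" "y \<in> carrier (power_rtimes_sym H n)"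
  shows "x \<otimes>\<^bsub>power_rtimes_sym H n\<^esub> y \<in> carrier (power_rtimes_sym H n)"
proof -
  obtain f \<pi> g \<rho> where xy: "x = (f, \<pi>)" "y = (g, \<rho>)" by (meson surj_pair)
  have \<pi>: "\<pi> permutes {0..<n}" and \<rho>: "\<rho> permutes {0..<n}"
    and f: "f \<in> {0..<n} \<rightarrow>\<^sub>E carrier H" and g: "g \<in> {0..<n} \<rightarrow>\<^sub>E carrier H"
    using assms(2,3) by (auto simp: power_rtimes_sym_def xy)
  have "inv_into UNIV \<pi> i \<in> {0..<n}" if "i \<in> {0..<n}" for i
    using permutes_in_image[OF permutes_inv[OF \<pi>]] that by blast
  then have "f i \<otimes>\<^bsub>H\<^esub> g (inv_into UNIV \<pi> i) \<in> carrier H" if "i \<in> {0..<n}" for i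
    using that H f g by (meson PiE_mem)
  then show ?thesis
    using permutes_compose[OF \<rho> \<pi>] by (simp add: power_rtimes_sym_def xy)
qed

text \<open>A tower presents \<open>(X, T)\<close> as \<open>q\<close> copies of \<open>(Y, \<tau>)\<close>: the map \<open>x \<mapsto> (\<kappa> x, r x)\<close> is a homeomorphism of \<open>X\<close>
  onto \<open>{0..<q} \<times> Y\<close> with inverse \<open>s\<close>. The hypothesis \<open>level_transitive\<close> stands in for minimality of \<open>\<tau>\<close>:
  it forces maps commuting with \<open>T\<close> to permute the copies.\<close>

locale tower =
  fixes X :: "'x topology" and Y :: "'y topology"
    and T :: "'x \<Rightarrow> 'x" and \<tau> :: "'y \<Rightarrow> 'y" and q :: nat
    and \<kappa> :: "'x \<Rightarrow> nat" and r :: "'x \<Rightarrow> 'y" and s :: "nat \<Rightarrow> 'y \<Rightarrow> 'x"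
  assumes level_less: "x \<in> topspace X \<Longrightarrow> \<kappa> x < q"
    and level_open: "openin X {x \<in> topspace X. \<kappa> x = c}"
    and cont_r: "continuous_map X Y r"
    and cont_s: "c < q \<Longrightarrow> continuous_map Y X (s c)"
    and level_s: "c < q \<Longrightarrow> y \<in> topspace Y \<Longrightarrow> \<kappa> (s c y) = c"
    and r_s: "c < q \<Longrightarrow> y \<in> topspace Y \<Longrightarrow> r (s c y) = y"
    and s_r: "x \<in> topspace X \<Longrightarrow> s (\<kappa> x) (r x) = x"
    and \<tau>_in: "y \<in> topspace Y \<Longrightarrow> \<tau> y \<in> topspace Y"
    and s_\<tau>: "c < q \<Longrightarrow> y \<in> topspace Y \<Longrightarrow> s c (\<tau> y) = T (s c y)"
    and level_transitive: "\<And>F c y y'. continuous_map X X F \<Longrightarrow>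
      (\<And>x. x \<in> topspace X \<Longrightarrow> F (T x) = T (F x)) \<Longrightarrow> c < q \<Longrightarrow>
      y \<in> topspace Y \<Longrightarrow> y' \<in> topspace Y \<Longrightarrow> \<kappa> (F (s c y)) = \<kappa> (F (s c y'))"
    and nonempty: "topspace Y \<noteq> {}"
begin

lemma r_in: "x \<in> topspace X \<Longrightarrow> r x \<in> topspace Y"
  using cont_r by (auto simp: continuous_map_def)

lemma s_in: "c < q \<Longrightarrow> y \<in> topspace Y \<Longrightarrow> s c y \<in> topspace X"
  using cont_s by (auto simp: continuous_map_def)

lemma T_eq: "x \<in> topspace X \<Longrightarrow> T x = s (\<kappa> x) (\<tau> (r x))"
  using s_\<tau>[OF level_less r_in, of x x] s_r[of x] by simp

lemma T_in: "x \<in> topspace X \<Longrightarrow> T x \<in> topspace X"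
  by (simp add: T_eq s_in level_less \<tau>_in r_in)

lemma level_T: "x \<in> topspace X \<Longrightarrow> \<kappa> (T x) = \<kappa> x"
  by (simp add: T_eq level_s level_less \<tau>_in r_in)

lemma r_T: "x \<in> topspace X \<Longrightarrow> r (T x) = \<tau> (r x)"
  by (simp add: T_eq r_s level_less \<tau>_in r_in)

definition relocate :: "(nat \<Rightarrow> 'y \<Rightarrow> 'y) \<Rightarrow> (nat \<Rightarrow> nat) \<Rightarrow> 'x \<Rightarrow> 'x" where
  "relocate h \<pi> x = s (\<pi> (\<kappa> x)) (h (\<kappa> x) (r x))"

lemma continuous_relocate:
  assumes h: "\<And>c. c < q \<Longrightarrow> continuous_map Y Y (h c)" and \<pi>: "\<And>c. c < q \<Longrightarrow> \<pi> c < q"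
  shows "continuous_map X X (relocate h \<pi>)"
proof (rule pasting_lemma[where I = "{0..<q}" and T = "\<lambda>c. {x \<in> topspace X. \<kappa> x = c}"
      and f = "\<lambda>c x. s (\<pi> c) (h c (r x))"])
  fix c assume c: "c \<in> {0..<q}"
  have "continuous_map X X (s (\<pi> c) \<circ> (h c \<circ> r))"
    using c cont_r h cont_s \<pi> by (intro continuous_map_compose) auto
  then show "continuous_map (subtopology X {x \<in> topspace X. \<kappa> x = c}) X (\<lambda>x. s (\<pi> c) (h c (r x)))"
    by (simp add: o_def continuous_map_from_subtopology)
qed (use level_open level_less in \<open>auto simp: relocate_def\<close>)

lemma relocate_relocate:
  assumes "\<And>c y. c < q \<Longrightarrow> y \<in> topspace Y \<Longrightarrow> h c y \<in> topspace Y"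
    and "\<And>c. c < q \<Longrightarrow> \<pi> c < q" "x \<in> topspace X"
  shows "relocate h' \<pi>' (relocate h \<pi> x) = relocate (\<lambda>c. h' (\<pi> c) \<circ> h c) (\<pi>' \<circ> \<pi>) x"
  using assms by (simp add: relocate_def level_s r_s r_in level_less)

lemma relocate_id:
  assumes "x \<in> topspace X" "\<pi> (\<kappa> x) = \<kappa> x" "h (\<kappa> x) (r x) = r x"
  shows "relocate h \<pi> x = x"
  using assms by (simp add: relocate_def s_r)

text \<open>The coordinates are indexed by the target copy: \<open>f i\<close> acts on the way into copy \<open>i\<close>. This is what
  makes \<open>glue\<close> multiplicative for the convention \<open>(\<pi> . g) i = g (\<pi>\<inverse> i)\<close>.\<close>

definition glue :: "(nat \<Rightarrow> 'y \<Rightarrow> 'y) \<times> (nat \<Rightarrow> nat) \<Rightarrow> 'x \<Rightarrow> 'x" where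
  "glue = (\<lambda>(f, \<pi>). \<lambda>x\<in>topspace X. relocate (\<lambda>c. f (\<pi> c)) \<pi> x)"

lemma in_power_rtimes_symE:
  assumes "z \<in> carrier (power_rtimes_sym (aut_group Y \<tau>) q)"
  obtains f \<pi> where "z = (f, \<pi>)" "f \<in> {0..<q} \<rightarrow>\<^sub>E carrier (aut_group Y \<tau>)" "\<pi> permutes {0..<q}"
    "\<And>c. c < q \<Longrightarrow> \<pi> c < q" "\<And>c. c < q \<Longrightarrow> inv_into UNIV \<pi> c < q"
    "\<And>c y. c < q \<Longrightarrow> y \<in> topspace Y \<Longrightarrow> f c y \<in> topspace Y"
proof -
  obtain f \<pi> where z: "z = (f, \<pi>)" "f \<in> {0..<q} \<rightarrow>\<^sub>E carrier (aut_group Y \<tau>)" "\<pi> permutes {0..<q}"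
    using assms by (auto simp: power_rtimes_sym_def)
  have "\<pi> c < q" if "c < q" for c
    using permutes_in_image[OF z(3), of c] that by simp
  moreover have "inv_into UNIV \<pi> c < q" if "c < q" for c
    using permutes_in_image[OF permutes_inv[OF z(3)], of c] that by simp
  moreover have "f c y \<in> topspace Y" if "c < q" "y \<in> topspace Y" for c y
  proof -
    have "f c \<in> carrier (aut_group Y \<tau>)" using PiE_mem[OF z(2), of c] that(1) by simp
    then have "f c ` topspace Y = topspace Y"
      by (intro homeomorphic_imp_surjective_map) (simp add: aut_group_def)
    then show ?thesis using that(2) by blast
  qed
  ultimately show thesis using that z by blast
qed

lemma glue_in_aut:
  assumes "z \<in> carrier (power_rtimes_sym (aut_group Y \<tau>) q)"
  shows "glue z \<in> carrier (aut_group X T)"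
proof -
  obtain f \<pi> where z: "z = (f, \<pi>)" and f: "f \<in> {0..<q} \<rightarrow>\<^sub>E carrier (aut_group Y \<tau>)"
    and \<pi>: "\<pi> permutes {0..<q}" and less: "\<And>c. c < q \<Longrightarrow> \<pi> c < q" "\<And>c. c < q \<Longrightarrow> inv_into UNIV \<pi> c < q"
    and fY: "\<And>c y. c < q \<Longrightarrow> y \<in> topspace Y \<Longrightarrow> f c y \<in> topspace Y"
    using in_power_rtimes_symE[OF assms] by metis
  have \<pi>_inv: "inv_into UNIV \<pi> (\<pi> c) = c" "\<pi> (inv_into UNIV \<pi> c) = c" for c
    using permutes_inverses[OF \<pi>] by auto
  have "\<exists>g. homeomorphic_maps Y Y (f c) g" if "c < q" for c
    using PiE_mem[OF f, of c] that by (auto simp: aut_group_def homeomorphic_map_maps)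
  then obtain g where g: "\<And>c. c < q \<Longrightarrow> homeomorphic_maps Y Y (f c) (g c)" by metis
  have f\<tau>: "f c (\<tau> y) = \<tau> (f c y)" if "c < q" "y \<in> topspace Y" for c y
    using PiE_mem[OF f, of c] that by (auto simp: aut_group_def)
  have gY: "g c y \<in> topspace Y" if "c < q" "y \<in> topspace Y" for c y
    using g[OF that(1)] that(2) by (auto simp: homeomorphic_maps_def continuous_map_def)
  have fg: "f c (g c y) = y" "g c (f c y) = y" if "c < q" "y \<in> topspace Y" for c y
    using g[OF that(1)] that(2) by (auto simp: homeomorphic_maps_def)
  let ?F = "relocate (\<lambda>c. f (\<pi> c)) \<pi>" and ?G = "relocate g (inv_into UNIV \<pi>)"
  have "homeomorphic_maps X X ?F ?G"
    unfolding homeomorphic_maps_def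
  proof (intro conjI ballI)
    show "continuous_map X X ?F" "continuous_map X X ?G"
      using g less by (auto intro!: continuous_relocate simp: homeomorphic_maps_def)
    fix x assume x: "x \<in> topspace X"
    show "?G (?F x) = x"
      using x fY less by (subst relocate_relocate)
        (auto intro!: relocate_id simp: \<pi>_inv fg level_less r_in)
    show "?F (?G x) = x"
      using x gY less by (subst relocate_relocate)
        (auto intro!: relocate_id simp: \<pi>_inv fg level_less r_in)
  qed
  then have "homeomorphic_maps X X (glue z) ?G"
    by (rule homeomorphic_maps_eq) (auto simp: glue_def z)
  moreover have "glue z (T x) = T (glue z x)" if x: "x \<in> topspace X" for x
    using x by (simp add: glue_def z T_in relocate_def level_T r_T f\<tau> less level_less r_in s_\<tau> fY)
  ultimately show ?thesis by (intro aut_groupI) (auto simp: glue_def z)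
qed

lemma glue_mult:
  assumes "z \<in> carrier (power_rtimes_sym (aut_group Y \<tau>) q)"
    and "w \<in> carrier (power_rtimes_sym (aut_group Y \<tau>) q)"
  shows "glue (z \<otimes>\<^bsub>power_rtimes_sym (aut_group Y \<tau>) q\<^esub> w) = compose (topspace X) (glue z) (glue w)"
proof
  fix x
  obtain f \<pi> where z: "z = (f, \<pi>)" and \<pi>: "\<pi> permutes {0..<q}" and \<pi>_less: "\<And>c. c < q \<Longrightarrow> \<pi> c < q"
    using in_power_rtimes_symE[OF assms(1)] by metis
  obtain g \<rho> where w: "w = (g, \<rho>)" and \<rho>_less: "\<And>c. c < q \<Longrightarrow> \<rho> c < q"
    and gY: "\<And>c y. c < q \<Longrightarrow> y \<in> topspace Y \<Longrightarrow> g c y \<in> topspace Y"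
    using in_power_rtimes_symE[OF assms(2)] by metis
  have \<pi>_inv: "inv_into UNIV \<pi> (\<pi> c) = c" for c
    using permutes_inverses[OF \<pi>] by auto
  show "glue (z \<otimes>\<^bsub>power_rtimes_sym (aut_group Y \<tau>) q\<^esub> w) x = compose (topspace X) (glue z) (glue w) x"
  proof (cases "x \<in> topspace X")
    case True
    have "relocate (\<lambda>c. g (\<rho> c)) \<rho> x \<in> topspace X"
      using True by (simp add: relocate_def s_in \<rho>_less level_less gY r_in)
    then show ?thesis
      using True by (simp add: glue_def z w power_rtimes_sym_def aut_group_def compose_eq relocate_def
          level_s r_s \<rho>_less \<pi>_less level_less r_in gY \<pi>_inv)
  qed (simp add: glue_def compose_def power_rtimes_sym_def z w)
qed

text \<open>The copy into which copy \<open>c\<close> is sent reveals \<open>\<pi> c\<close>, which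
  takes one point of \<open>Y\<close>; the \<open>Y\<close>-coordinate of the image then reveals
  \<open>f (\<pi> c)\<close>.\<close>

lemma inj_on_glue: "inj_on glue (carrier (power_rtimes_sym (aut_group Y \<tau>) q))"
proof (rule inj_onI)
  fix z w assume z': "z \<in> carrier (power_rtimes_sym (aut_group Y \<tau>) q)"
    and w': "w \<in> carrier (power_rtimes_sym (aut_group Y \<tau>) q)" and eq: "glue z = glue w"
  obtain f \<pi> where z: "z = (f, \<pi>)" and f: "f \<in> {0..<q} \<rightarrow>\<^sub>E carrier (aut_group Y \<tau>)"
    and \<pi>: "\<pi> permutes {0..<q}" "\<And>c. c < q \<Longrightarrow> \<pi> c < q" "\<And>c. c < q \<Longrightarrow> inv_into UNIV \<pi> c < q"
    and fY: "\<And>c y. c < q \<Longrightarrow> y \<in> topspace Y \<Longrightarrow> f c y \<in> topspace Y"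
    using in_power_rtimes_symE[OF z'] by metis
  obtain g \<rho> where w: "w = (g, \<rho>)" and g: "g \<in> {0..<q} \<rightarrow>\<^sub>E carrier (aut_group Y \<tau>)"
    and \<rho>: "\<rho> permutes {0..<q}" "\<And>c. c < q \<Longrightarrow> \<rho> c < q"
    and gY: "\<And>c y. c < q \<Longrightarrow> y \<in> topspace Y \<Longrightarrow> g c y \<in> topspace Y"
    using in_power_rtimes_symE[OF w'] by metis
  have *: "s (\<pi> c) (f (\<pi> c) y) = s (\<rho> c) (g (\<rho> c) y)" if "c < q" "y \<in> topspace Y" for c y
    using fun_cong[OF eq, of "s c y"] that
    by (simp add: glue_def z w s_in relocate_def level_s r_s)
  have perm: "\<pi> c = \<rho> c" if "c < q" for c
  proof -
    obtain y where "y \<in> topspace Y" using nonempty by blast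
    then show ?thesis
      using arg_cong[OF *[OF that], of y \<kappa>] that by (simp add: level_s \<pi> \<rho> fY gY)
  qed
  have "\<pi> c = \<rho> c" for c
    using perm[of c] permutes_not_in[OF \<pi>(1), of c] permutes_not_in[OF \<rho>(1), of c]
    by (cases "c < q") auto
  moreover have "f = g"
  proof (rule PiE_ext[OF f g])
    fix i assume "i \<in> {0..<q}"
    then have i: "i < q" "inv_into UNIV \<pi> i < q" "\<pi> (inv_into UNIV \<pi> i) = i" "\<rho> (inv_into UNIV \<pi> i) = i"
      using \<pi>(3) permutes_inverses[OF \<pi>(1)] perm[of "inv_into UNIV \<pi> i"] by auto
    have "f i y = g i y" if y: "y \<in> topspace Y" for y
      using arg_cong[OF *[OF i(2) y], of r] i y by (simp add: r_s fY gY)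
    moreover have "f i \<in> extensional (topspace Y)" "g i \<in> extensional (topspace Y)"
      using PiE_mem[OF f, of i] PiE_mem[OF g, of i] i by (auto simp: aut_group_def)
    ultimately show "f i = g i" by (metis extensionalityI)
  qed
  ultimately show "z = w" by (auto simp: z w)
qed

lemma glue_surj:
  assumes "F \<in> carrier (aut_group X T)"
  shows "F \<in> glue ` carrier (power_rtimes_sym (aut_group Y \<tau>) q)"
proof -
  obtain G where FG: "homeomorphic_maps X X F G" and ext: "F \<in> extensional (topspace X)"
    and FT: "\<And>x. x \<in> topspace X \<Longrightarrow> F (T x) = T (F x)"
    and GT: "\<And>x. x \<in> topspace X \<Longrightarrow> G (T x) = T (G x)"
    using aut_groupE[OF assms] T_in by (metis Pi_I)
  have cF: "continuous_map X X F" and cG: "continuous_map X X G"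
    using FG by (auto simp: homeomorphic_maps_def)
  have FX: "F x \<in> topspace X" and GX: "G x \<in> topspace X" and GF: "G (F x) = x" and FG': "F (G x) = x"
    if "x \<in> topspace X" for x
    using FG that by (auto simp: homeomorphic_maps_def continuous_map_def)
  obtain y0 where y0: "y0 \<in> topspace Y" using nonempty by blast
  \<comment> \<open>By \<open>level_transitive\<close> the base point \<open>y0\<close> is
    immaterial. The value \<open>c\<close> for \<open>c \<ge> q\<close> makes \<open>lev F\<close>
    fix everything outside \<open>{0..<q}\<close>, as \<open>permutes\<close> demands.\<close>
  define lev where "lev H c = (if c < q then \<kappa> (H (s c y0)) else c)" for H c
  have lev: "\<kappa> (H x) = lev H (\<kappa> x)" if "continuous_map X X H" "\<And>x. x \<in> topspace X \<Longrightarrow> H (T x) = T (H x)"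
    "x \<in> topspace X" for H x
    using level_transitive[of H "\<kappa> x" "r x" y0] that y0 by (simp add: lev_def level_less r_in s_r)
  note levF = lev[OF cF FT] and levG = lev[OF cG GT]
  define \<pi> where "\<pi> = lev F"
  have GF_lev: "lev G (lev F c) = c" for c
  proof (cases "c < q")
    case True
    then show ?thesis
      using levF[of "s c y0"] levG[of "F (s c y0)"] by (simp add: s_in y0 FX GF level_s)
  qed (simp add: lev_def)
  have FG_lev: "lev F (lev G c) = c" for c
  proof (cases "c < q")
    case True
    then show ?thesis
      using levG[of "s c y0"] levF[of "G (s c y0)"] by (simp add: s_in y0 GX FG' level_s)
  qed (simp add: lev_def)
  have bij: "bij \<pi>" unfolding \<pi>_def by (rule o_bij[of "lev G"]) (auto simp: GF_lev FG_lev fun_eq_iff)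
  have inv_\<pi>: "inv_into UNIV \<pi> = lev G" unfolding \<pi>_def by (rule inv_unique_comp) (auto simp: GF_lev FG_lev fun_eq_iff)
  have perm: "\<pi> permutes {0..<q}"
    unfolding permutes_def
  proof (intro conjI allI impI)
    show "\<pi> c = c" if "c \<notin> {0..<q}" for c using that by (auto simp: \<pi>_def lev_def)
    show "\<exists>!c. \<pi> c = c'" for c' using bij by (simp add: bij_iff)
  qed
  have G_less: "lev G c < q" if "c < q" for c
    using that by (simp add: lev_def level_less s_in GX y0)
  \<comment> \<open>Coordinate \<open>i\<close> belongs to the target copy, so it reads
    \<open>F\<close> on the source copy \<open>\<pi>\<inverse> i\<close>.\<close>
  define f where "f = (\<lambda>i\<in>{0..<q}. \<lambda>y\<in>topspace Y. r (F (s (inv_into UNIV \<pi> i) y)))"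
  have "f i \<in> carrier (aut_group Y \<tau>)" if i: "i < q" for i
  proof (rule aut_groupI)
    have i': "inv_into UNIV \<pi> i < q" using G_less i by (simp add: inv_\<pi>)
    have \<kappa>F: "\<kappa> (F (s (inv_into UNIV \<pi> i) y)) = i" if "y \<in> topspace Y" for y
      using that i' by (simp add: levF s_in level_s inv_\<pi> FG_lev)
    have \<kappa>G: "\<kappa> (G (s i y)) = inv_into UNIV \<pi> i" if "y \<in> topspace Y" for y
      using that i by (simp add: levG s_in level_s inv_\<pi>)
    have "homeomorphic_maps Y Y (r \<circ> (F \<circ> s (inv_into UNIV \<pi> i))) (r \<circ> (G \<circ> s i))"
      unfolding homeomorphic_maps_def
    proof (intro conjI ballI)
      show "continuous_map Y Y (r \<circ> (F \<circ> s (inv_into UNIV \<pi> i)))" "continuous_map Y Y (r \<circ> (G \<circ> s i))"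
        by (meson i i' cF cG cont_r cont_s continuous_map_compose)+
      fix y assume y: "y \<in> topspace Y"
      have "s i (r (F (s (inv_into UNIV \<pi> i) y))) = F (s (inv_into UNIV \<pi> i) y)"
        using s_r[OF FX[OF s_in[OF i' y]]] \<kappa>F[OF y] by simp
      then show "(r \<circ> (G \<circ> s i)) ((r \<circ> (F \<circ> s (inv_into UNIV \<pi> i))) y) = y"
        using i' y by (simp add: GF s_in r_s)
      have "s (inv_into UNIV \<pi> i) (r (G (s i y))) = G (s i y)"
        using s_r[OF GX[OF s_in[OF i y]]] \<kappa>G[OF y] by simp
      then show "(r \<circ> (F \<circ> s (inv_into UNIV \<pi> i))) ((r \<circ> (G \<circ> s i)) y) = y"
        using i y by (simp add: FG' s_in r_s)
    qed
    then show "homeomorphic_maps Y Y (f i) (r \<circ> (G \<circ> s i))"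
      by (rule homeomorphic_maps_eq) (use i in \<open>auto simp: f_def\<close>)
    show "f i \<in> extensional (topspace Y)" using i by (simp add: f_def)
    show "f i (\<tau> y) = \<tau> (f i y)" if "y \<in> topspace Y" for y
      using that i i' by (simp add: f_def \<tau>_in s_\<tau> FT s_in r_T FX)
  qed
  then have mem: "(f, \<pi>) \<in> carrier (power_rtimes_sym (aut_group Y \<tau>) q)"
    using perm by (auto simp: power_rtimes_sym_def f_def)
  have "glue (f, \<pi>) x = F x" for x
  proof (cases "x \<in> topspace X")
    case True
    have \<kappa>F: "\<kappa> (F x) = \<pi> (\<kappa> x)" using levF True by (simp add: \<pi>_def)
    have "glue (f, \<pi>) x = s (\<kappa> (F x)) (f (\<kappa> (F x)) (r x))"
      using True by (simp add: glue_def relocate_def \<kappa>F)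
    also have "f (\<kappa> (F x)) (r x) = r (F (s (inv_into UNIV \<pi> (\<pi> (\<kappa> x))) (r x)))"
      unfolding \<kappa>F[symmetric] f_def using level_less[OF FX[OF True]] r_in[OF True] by simp
    also have "inv_into UNIV \<pi> (\<pi> (\<kappa> x)) = \<kappa> x" unfolding inv_\<pi> unfolding \<pi>_def by (rule GF_lev)
    finally show ?thesis using True by (simp add: s_r FX)
  next
    case False
    then show ?thesis using extensional_arb[OF ext False] by (simp add: glue_def)
  qed
  then have "glue (f, \<pi>) = F" ..
  then show ?thesis using mem by blast
qed

lemma bij_betw_glue:
  "bij_betw glue (carrier (power_rtimes_sym (aut_group Y \<tau>) q)) (carrier (aut_group X T))"
  using inj_on_glue glue_in_aut glue_surj by (auto simp: bij_betw_def)

end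

section \<open>Window description of the topology\<close>

definition translate :: "int \<Rightarrow> (int \<Rightarrow> 'a) \<Rightarrow> int \<Rightarrow> 'a" where
  "translate n x = (\<lambda>i. x (i + n))"

definition agree :: "int \<Rightarrow> (int \<Rightarrow> 'a) \<Rightarrow> (int \<Rightarrow> 'a) \<Rightarrow> bool" where
  "agree N x y \<longleftrightarrow> (\<forall>i. \<bar>i\<bar> \<le> N \<longrightarrow> x i = y i)"

lemma translate_apply: "translate n x i = x (i + n)" by (simp add: translate_def)

lemma translate_translate [simp]: "translate m (translate n x) = translate (m + n) x"
  by (simp add: translate_def algebra_simps)

lemma translate_0 [simp]: "translate 0 x = x" by (simp add: translate_def)

lemma shift_funpow: "shift ^^ n = translate (int n)"
  by (induction n) (auto simp: shift_def translate_def fun_eq_iff algebra_simps)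

lemma shift_eq_translate: "shift = translate 1"
  by (auto simp: shift_def translate_def)

lemma agree_mono: "agree N x y \<Longrightarrow> M \<le> N \<Longrightarrow> agree M x y"
  by (auto simp: agree_def)

lemma agree_sym: "agree N x y \<Longrightarrow> agree N y x"
  by (auto simp: agree_def)

lemma agree_trans: "agree N x y \<Longrightarrow> agree N y z \<Longrightarrow> agree N x z"
  by (auto simp: agree_def)

lemma agree_refl [simp]: "agree N x x"
  by (auto simp: agree_def)

lemma agree_translate: "agree (N + \<bar>n\<bar>) x y \<Longrightarrow> agree N (translate n x) (translate n y)"
  by (auto simp: agree_def translate_def)

lemma eq_if_agree: "(\<And>N. agree N x y) \<Longrightarrow> x = y"
  unfolding agree_def by (metis ext order_refl)

text \<open>A basic open set of the product constrains finitely many coordinates, so one symmetric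
  window contains them all; conversely a window is itself such a constraint.\<close>

lemma openin_full_shift:
  fixes U :: "(int \<Rightarrow> 'a) set"
  shows "openin full_shift_top U \<longleftrightarrow> (\<forall>x\<in>U. \<exists>N. \<forall>y. agree N x y \<longrightarrow> y \<in> U)"
proof
  assume U: "openin full_shift_top U"
  show "\<forall>x\<in>U. \<exists>N. \<forall>y. agree N x y \<longrightarrow> y \<in> U"
  proof
    fix x assume "x \<in> U"
    then obtain V where V: "finite {i. V i \<noteq> (UNIV :: 'a set)}" "x \<in> Pi\<^sub>E UNIV V" "Pi\<^sub>E UNIV V \<subseteq> U"
      using U unfolding full_shift_top_def openin_product_topology_alt by auto
    define N where "N = Max (insert 0 (abs ` {i. V i \<noteq> UNIV}))"
    have N: "\<bar>i\<bar> \<le> N" if "V i \<noteq> UNIV" for i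
      unfolding N_def using V(1) that by (intro Max_ge) auto
    have "y \<in> U" if "agree N x y" for y
    proof -
      have "y i \<in> V i" for i
      proof (cases "V i = UNIV")
        case False
        then have "y i = x i" using N that by (simp add: agree_def)
        then show ?thesis using V(2) by auto
      qed simp
      then show ?thesis using V(3) by auto
    qed
    then show "\<exists>N. \<forall>y. agree N x y \<longrightarrow> y \<in> U" by blast
  qed
next
  assume *: "\<forall>x\<in>U. \<exists>N. \<forall>y. agree N x y \<longrightarrow> y \<in> U"
  show "openin full_shift_top U"
    unfolding full_shift_top_def openin_product_topology_alt
  proof
    fix x assume "x \<in> U"
    then obtain N where N: "\<And>y. agree N x y \<Longrightarrow> y \<in> U" using * by blast
    define V where "V i = (if \<bar>i\<bar> \<le> N then {x i} else UNIV)" for i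
    have "{i. V i \<noteq> UNIV} \<subseteq> {-N..N}" by (auto simp: V_def split: if_splits)
    then have "finite {i. V i \<noteq> UNIV}" by (rule finite_subset) simp
    moreover have "x \<in> Pi\<^sub>E UNIV V" by (auto simp: V_def)
    moreover have "Pi\<^sub>E UNIV V \<subseteq> U"
    proof
      fix y assume "y \<in> Pi\<^sub>E UNIV V"
      then have "y i \<in> V i" for i by auto
      then have "agree N x y" unfolding agree_def V_def by (metis singletonD)
      then show "y \<in> U" by (rule N)
    qed
    ultimately show "\<exists>U'. finite {i \<in> UNIV. U' i \<noteq> topspace (discrete_topology UNIV)} \<and>
        (\<forall>i\<in>UNIV. openin (discrete_topology UNIV) (U' i)) \<and> x \<in> Pi\<^sub>E UNIV U' \<and> Pi\<^sub>E UNIV U' \<subseteq> U"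
      by (intro exI[of _ V]) auto
  qed
qed

lemma topspace_full_shift [simp]: "topspace full_shift_top = UNIV"
  by (simp add: full_shift_top_def)

lemma openin_full_shift_sub:
  "openin (subtopology full_shift_top A) U \<longleftrightarrow> U \<subseteq> A \<and> (\<forall>x\<in>U. \<exists>N. \<forall>y\<in>A. agree N x y \<longrightarrow> y \<in> U)"
proof
  assume "openin (subtopology full_shift_top A) U"
  then show "U \<subseteq> A \<and> (\<forall>x\<in>U. \<exists>N. \<forall>y\<in>A. agree N x y \<longrightarrow> y \<in> U)"
    unfolding openin_subtopology openin_full_shift by blast
next
  assume *: "U \<subseteq> A \<and> (\<forall>x\<in>U. \<exists>N. \<forall>y\<in>A. agree N x y \<longrightarrow> y \<in> U)"
  \<comment> \<open>An extension of \<open>U\<close> to an open set of the full shift: the union of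
    the cylinders around points of \<open>U\<close> whose trace on \<open>A\<close> stays in
    \<open>U\<close>.\<close>
  define V where "V = {z. \<exists>x\<in>U. \<exists>N. agree N x z \<and> (\<forall>y\<in>A. agree N x y \<longrightarrow> y \<in> U)}"
  have "openin full_shift_top V"
    unfolding openin_full_shift
  proof
    fix z assume "z \<in> V"
    then obtain x N where x: "x \<in> U" "agree N x z" "\<forall>y\<in>A. agree N x y \<longrightarrow> y \<in> U" by (auto simp: V_def)
    have "w \<in> V" if "agree N z w" for w
      using x agree_trans[OF x(2) that] unfolding V_def by blast
    then show "\<exists>N. \<forall>y. agree N z y \<longrightarrow> y \<in> V" by blast
  qed
  moreover have "U = V \<inter> A"
  proof
    show "U \<subseteq> V \<inter> A"
    proof
      fix x assume "x \<in> U"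
      then show "x \<in> V \<inter> A" using * agree_refl[of _ x] unfolding V_def by blast
    qed
  qed (auto simp: V_def)
  ultimately show "openin (subtopology full_shift_top A) U" unfolding openin_subtopology by blast
qed

lemma continuous_map_full_shift_sub:
  "continuous_map (subtopology full_shift_top A) (subtopology full_shift_top B) g \<longleftrightarrow>
    g \<in> A \<rightarrow> B \<and> (\<forall>x\<in>A. \<forall>N. \<exists>M. \<forall>y\<in>A. agree M x y \<longrightarrow> agree N (g x) (g y))"
proof
  assume c: "continuous_map (subtopology full_shift_top A) (subtopology full_shift_top B) g"
  then have gAB: "g \<in> A \<rightarrow> B" by (auto simp: continuous_map_def)
  have "\<exists>M. \<forall>y\<in>A. agree M x y \<longrightarrow> agree N (g x) (g y)" if "x \<in> A" for x N
  proof -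
    have "openin (subtopology full_shift_top B) {z \<in> B. agree N (g x) z}"
      unfolding openin_full_shift_sub using agree_trans by blast
    then have "openin (subtopology full_shift_top A) {y \<in> A. g y \<in> {z \<in> B. agree N (g x) z}}"
      using c unfolding continuous_map_def topspace_subtopology topspace_full_shift Int_UNIV_left by blast
    then show ?thesis
      using that gAB unfolding openin_full_shift_sub by fastforce
  qed
  with gAB show "g \<in> A \<rightarrow> B \<and> (\<forall>x\<in>A. \<forall>N. \<exists>M. \<forall>y\<in>A. agree M x y \<longrightarrow> agree N (g x) (g y))" by blast
next
  assume *: "g \<in> A \<rightarrow> B \<and> (\<forall>x\<in>A. \<forall>N. \<exists>M. \<forall>y\<in>A. agree M x y \<longrightarrow> agree N (g x) (g y))"
  show "continuous_map (subtopology full_shift_top A) (subtopology full_shift_top B) g"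
    unfolding continuous_map_def
  proof (intro conjI allI impI)
    show "g \<in> topspace (subtopology full_shift_top A) \<rightarrow> topspace (subtopology full_shift_top B)"
      using * by simp
    fix U assume U: "openin (subtopology full_shift_top B) U"
    show "openin (subtopology full_shift_top A) {x \<in> topspace (subtopology full_shift_top A). g x \<in> U}"
      unfolding openin_full_shift_sub
    proof (intro conjI ballI)
      fix x assume x: "x \<in> {x \<in> topspace (subtopology full_shift_top A). g x \<in> U}"
      then obtain N where N: "\<forall>y\<in>B. agree N (g x) y \<longrightarrow> y \<in> U"
        using U unfolding openin_full_shift_sub by auto
      from x have "x \<in> A" by simp
      then obtain M where "\<forall>y\<in>A. agree M x y \<longrightarrow> agree N (g x) (g y)" using * by blast
      then show "\<exists>M. \<forall>y\<in>A. agree M x y \<longrightarrow>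
          y \<in> {x \<in> topspace (subtopology full_shift_top A). g x \<in> U}"
        using N * by (intro exI[of _ M]) (auto simp: Pi_iff)
    qed auto
  qed
qed

section \<open>Minimal components of powers of the shift\<close>

text \<open>The closure of \<open>{\<sigma>^(i + q m) u | m}\<close>.\<close>

definition cell :: "(int \<Rightarrow> 'a) \<Rightarrow> nat \<Rightarrow> int \<Rightarrow> (int \<Rightarrow> 'a) set" where
  "cell u q i = {x. \<forall>N. \<exists>m. agree N x (translate (i + int q * m) u)}"

lemma cellD: "x \<in> cell u q i \<Longrightarrow> \<exists>m. agree N x (translate (i + int q * m) u)"
  by (simp add: cell_def)

lemma cellI: "(\<And>N. \<exists>m. agree N x (translate (i + int q * m) u)) \<Longrightarrow> x \<in> cell u q i"
  by (simp add: cell_def)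

lemma cell_closed:
  assumes "\<And>N. \<exists>y\<in>cell u q i. agree N x y"
  shows "x \<in> cell u q i"
  using assms by (meson agree_trans cellD cellI)

lemma translate_in_cell: "translate i u \<in> cell u q i"
  by (rule cellI) (rule exI[of _ 0], simp)

lemma translate_cell:
  assumes "x \<in> cell u q i"
  shows "translate n x \<in> cell u q (i + n)"
proof (rule cellI)
  fix N
  obtain m where "agree (N + \<bar>n\<bar>) x (translate (i + int q * m) u)" using cellD[OF assms] by blast
  from agree_translate[OF this] show "\<exists>m. agree N (translate n x) (translate (i + n + int q * m) u)"
    by (auto intro!: exI[of _ m] simp: algebra_simps)
qed

lemma cell_cong:
  assumes "int q dvd j - i"
  shows "cell u q i = cell u q j"
proof -
  have *: "cell u q i \<subseteq> cell u q j" if dvd: "int q dvd j - i" for i j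
  proof
    fix x assume x: "x \<in> cell u q i"
    obtain c where c: "j - i = int q * c" using dvd by (elim dvdE)
    show "x \<in> cell u q j"
    proof (rule cellI)
      fix N
      obtain m where m: "agree N x (translate (i + int q * m) u)" using cellD[OF x] by blast
      have "i + int q * m = j + int q * (m - c)" using c by (simp add: algebra_simps)
      with m show "\<exists>m. agree N x (translate (j + int q * m) u)" by auto
    qed
  qed
  show ?thesis using *[OF assms] *[of i j] assms by (simp add: dvd_diff_commute subset_antisym)
qed

lemma cell_mono:
  assumes "q dvd q'"
  shows "cell u q' i \<subseteq> cell u q i"
proof
  fix x assume x: "x \<in> cell u q' i"
  obtain c where "q' = q * c" using assms by blast
  then have "i + int q' * m = i + int q * (int c * m)" for m by simp
  then show "x \<in> cell u q i" using cellD[OF x] by (metis cellI)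
qed

lemma subshift_eq_cell: "subshift u = cell u 1 i"
proof -
  have "subshift u = cell u 1 0"
  proof
    show "subshift u \<subseteq> cell u 1 0"
    proof
      fix x assume x: "x \<in> subshift u"
      show "x \<in> cell u 1 0"
      proof (rule cellI)
        fix N
        have "openin full_shift_top {y. agree N x y}"
          unfolding openin_full_shift using agree_trans by blast
        then obtain y where "y \<in> orbit u" "y \<in> {y. agree N x y}"
          using x unfolding subshift_def in_closure_of by (metis agree_refl mem_Collect_eq)
        then show "\<exists>m. agree N x (translate (0 + int 1 * m) u)" by (auto simp: orbit_def translate_def)
      qed
    qed
    show "cell u 1 0 \<subseteq> subshift u"
    proof
      fix x assume x: "x \<in> cell u 1 0"
      show "x \<in> subshift u"
        unfolding subshift_def in_closure_of
      proof (intro conjI allI impI)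
        fix T assume "x \<in> T \<and> openin full_shift_top T"
        then obtain N where "\<And>y. agree N x y \<Longrightarrow> y \<in> T" unfolding openin_full_shift by blast
        moreover obtain m where "agree N x (translate (0 + int 1 * m) u)" using cellD[OF x] by blast
        ultimately show "\<exists>y. y \<in> orbit u \<and> y \<in> T"
          by (intro exI[of _ "translate m u"]) (auto simp: orbit_def translate_def)
      qed simp
    qed
  qed
  then show ?thesis using cell_cong[of 1 i 0 u] by simp
qed

lemma cell_subset_subshift: "x \<in> cell u q i \<Longrightarrow> x \<in> subshift u"
  using cell_mono[of 1 q u i] subshift_eq_cell[of u i] by auto

lemma translate_subshift: "x \<in> subshift u \<Longrightarrow> translate n x \<in> subshift u"
  using translate_cell subshift_eq_cell by metis

lemma topspace_subshift_top [simp]: "topspace (subshift_top u) = subshift u"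
  by (simp add: subshift_top_def)

text \<open>A point outside all \<open>q\<close> cells is separated from each by a window. The
  largest window still contains an approximation by some translate of \<open>u\<close>, whose
  residue modulo \<open>q\<close> names a cell.\<close>

lemma cell_cover:
  assumes x: "x \<in> subshift u" and q: "q \<ge> 1"
  shows "\<exists>c<q. x \<in> cell u q (int c)"
proof (rule ccontr)
  assume "\<not> ?thesis"
  then have "\<forall>c. \<exists>N. c < q \<longrightarrow> (\<forall>m. \<not> agree N x (translate (int c + int q * m) u))"
    unfolding cell_def by auto
  then obtain N where N: "\<And>c m. c < q \<Longrightarrow> \<not> agree (N c) x (translate (int c + int q * m) u)" by metis
  define L where "L = Max (N ` {0..<q})"
  obtain m where m: "agree L x (translate m u)" using cellD[of x u 1 0 L] x subshift_eq_cell[of u 0] by auto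
  define c where "c = nat (m mod int q)"
  have c: "c < q" using q by (simp add: c_def nat_less_iff)
  have "m = int c + int q * (m div int q)" using q by (simp add: c_def)
  then have "agree L x (translate (int c + int q * (m div int q)) u)" using m by metis
  moreover have "N c \<le> L" unfolding L_def using c by (intro Max_ge) auto
  ultimately show False using N[OF c] agree_mono by blast
qed

section \<open>Cells of a Toeplitz sequence with a period structure\<close>

locale toeplitz_structure =
  fixes u :: "int \<Rightarrow> 'a::finite" and p :: "nat \<Rightarrow> nat"
  assumes toep: "toeplitz u" and struct: "period_structure u p"
begin

lemma p_ge1: "p k \<ge> 1" and p_dvd_Suc: "p k dvd p (Suc k)" and p_essential: "essential_period u (p k)"
  and p_cover: "(\<Union>n. per u (p n)) = UNIV"
  using struct by (auto simp: period_structure_def)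

lemma p_dvd: "k \<le> l \<Longrightarrow> p k dvd p l"
  by (induction rule: dec_induct) (auto intro: dvd_trans p_dvd_Suc)

lemma per_mono:
  assumes "q dvd q'"
  shows "per u q \<subseteq> per u q'"
proof -
  obtain c where "q' = q * c" using assms by blast
  then have *: "int q' * m = int q * (int c * m)" for m by simp
  show ?thesis unfolding per_def * by blast
qed

lemma finite_subset_per:
  assumes "finite A"
  shows "\<exists>l\<ge>K. A \<subseteq> per u (p l)"
proof -
  have "\<forall>a. \<exists>n. a \<in> per u (p n)" using p_cover by blast
  then obtain n where n: "\<And>a. a \<in> per u (p (n a))" by metis
  define l where "l = Max (insert K (n ` A))"
  have "a \<in> per u (p l)" if "a \<in> A" for a
  proof -
    have "n a \<le> l" unfolding l_def using assms that by (intro Max_ge) auto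
    then show ?thesis using n per_mono[OF p_dvd] by blast
  qed
  moreover have "K \<le> l" unfolding l_def using assms by (intro Max_ge) auto
  ultimately show ?thesis by blast
qed

lemma perD: "k \<in> per u q \<Longrightarrow> int q dvd k' - k \<Longrightarrow> u k' = u k"
  unfolding per_def by (auto elim!: dvdE) (metis add_diff_cancel_left' diff_add_cancel add.commute)

text \<open>For \<open>q = p k\<close> the second conclusion says that the approximating powers of \<open>\<sigma>^n\<close> act on the \<open>k\<close>-th level of the
  odometer as the translation by \<open>e\<close>. The window of \<open>z\<close> has to be located in \<open>u\<close> first, since its period
  determines how much of \<open>x\<close> must be matched.\<close>

lemma orbit_approximates:
  assumes gcd: "\<And>l. l \<ge> K \<Longrightarrow> gcd (int n) (int (p l)) dvd d"
    and q: "q dvd p K" and dq: "d dvd int q" and de: "d dvd e" and n: "n \<ge> 1"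
    and x: "x \<in> cell u q j" and z: "z \<in> cell u q (j + e)"
  shows "\<exists>m. agree N z (translate (int n * m) x) \<and> int q dvd int n * m - e"
proof -
  obtain a where a: "agree N z (translate (j + e + int q * a) u)" using cellD[OF z] by blast
  define s where "s = j + e + int q * a"
  obtain l where l: "l \<ge> K" "{s - N..s + N} \<subseteq> per u (p l)"
    using finite_subset_per[of "{s - N..s + N}" K] by auto
  define M where "M = int (p l)"
  have M: "M > 0" using p_ge1[of l] by (simp add: M_def)
  \<comment> \<open>The radius must be fixed before the exponent \<open>m\<close>, which depends on
    \<open>b\<close>. Reducing \<open>m\<close> modulo \<open>M\<close> bounds the displacement by
    \<open>n M\<close>, so this radius is large enough.\<close>
  obtain b where b: "agree (\<bar>N\<bar> + int n * M) x (translate (j + int q * b) u)" using cellD[OF x] by blast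
  \<comment> \<open>With \<open>z\<close> near position \<open>j + e + q a\<close> of
    \<open>u\<close> and \<open>x\<close> near \<open>j + q b\<close>, the displacement
    \<open>n m\<close> has to equal \<open>e + q (a - b)\<close> modulo \<open>M\<close>. This is
    solvable because \<open>gcd n M\<close> divides \<open>d\<close>, hence both \<open>e\<close>
    and \<open>q\<close>.\<close>
  have "gcd (int n) M dvd e + int q * (a - b)"
    using gcd[OF l(1)] dq de by (metis M_def dvd_add dvd_mult2 dvd_trans)
  then obtain c where c: "e + int q * (a - b) = gcd (int n) M * c" by blast
  obtain y where "[int n * y = gcd (int n) M] (mod M)" using cong_solve_int by blast
  then have "[int n * (y * c) = e + int q * (a - b)] (mod M)"
    unfolding c mult.assoc[symmetric] by (rule cong_scalar_right)
  then obtain m0 where m0: "[int n * m0 = e + int q * (a - b)] (mod M)" by blast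
  define m where "m = m0 mod M"
  have m: "0 \<le> m" "m < M" using M by (auto simp: m_def)
  have "[int n * m = int n * m0] (mod M)" by (simp add: m_def cong_def mod_mult_right_eq)
  then have "[int n * m = e + int q * (a - b)] (mod M)" using m0 cong_trans by blast
  then have dvd: "M dvd int n * m - (e + int q * (a - b))" by (simp add: cong_iff_dvd_diff)
  have "z i = translate (int n * m) x i" if i: "\<bar>i\<bar> \<le> N" for i
  proof -
    have "int n * m \<le> int n * M" "0 \<le> int n * m" using m by (auto intro: mult_left_mono)
    then have "\<bar>i + int n * m\<bar> \<le> \<bar>N\<bar> + int n * M" using i by linarith
    then have "x (i + int n * m) = u (i + int n * m + (j + int q * b))"
      using b unfolding agree_def translate_def by blast
    also have "\<dots> = u (i + s)"
    proof (rule perD)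
      show "i + s \<in> per u (p l)" by (rule subsetD[OF l(2)]) (use i in \<open>auto simp: abs_le_iff\<close>)
      show "int (p l) dvd i + int n * m + (j + int q * b) - (i + s)"
        using dvd by (simp add: s_def M_def algebra_simps)
    qed
    also have "\<dots> = z i" using a i by (simp add: agree_def translate_def s_def)
    finally show ?thesis by (simp add: translate_def)
  qed
  then have "agree N z (translate (int n * m) x)" by (simp add: agree_def)
  moreover have "int q dvd int n * m - e"
  proof -
    have "int q dvd M" using q p_dvd[OF l(1)] unfolding M_def by (meson dvd_trans of_nat_dvd_iff)
    then have "int q dvd int n * m - (e + int q * (a - b))" using dvd by (rule dvd_trans)
    moreover have "int q dvd int q * (a - b)" by simp
    ultimately have "int q dvd int n * m - (e + int q * (a - b)) + int q * (a - b)" by (rule dvd_add)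
    then show ?thesis by simp
  qed
  ultimately show ?thesis by blast
qed

text \<open>The case \<open>n = q = d = p k\<close>, \<open>e = 0\<close>: this is the minimality of
  \<open>\<sigma>^(p k)\<close> on a cell.\<close>

lemma cell_orbit_dense:
  assumes "x \<in> cell u (p k) j" "z \<in> cell u (p k) j"
  shows "\<exists>m. agree N z (translate (int (p k) * m) x)"
  using orbit_approximates[of k "p k" "int (p k)" "p k" 0 x j z N] assms p_ge1 by auto

text \<open>By minimality a common point puts \<open>translate i u\<close> into the cell of
  \<open>j\<close>, so \<open>u\<close> recurs on every window at a displacement congruent to
  \<open>d = j - i\<close>. Hence the positions in \<open>per u q\<close>, with their symbols, are
  invariant under \<open>-d\<close>, and so under \<open>g = gcd d q\<close>. This gives
  \<open>per u g = per u q\<close>, and essentiality forces \<open>g = q\<close>.\<close>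

lemma cell_disjoint:
  assumes xi: "x \<in> cell u (p k) i" and xj: "x \<in> cell u (p k) j"
  shows "int (p k) dvd j - i"
proof -
  define q where "q = p k"
  define d where "d = j - i"
  have "translate i u \<in> cell u q j"
  proof (rule cell_closed)
    fix N
    obtain m where m: "agree N (translate i u) (translate (int q * m) x)"
      using cell_orbit_dense[OF xi translate_in_cell] by (auto simp: q_def)
    have "translate (int q * m) x \<in> cell u q (j + int q * m)" using xj translate_cell by (simp add: q_def)
    also have "\<dots> = cell u q j" by (rule cell_cong) simp
    finally show "\<exists>y\<in>cell u q j. agree N (translate i u) y" using m by blast
  qed
  then have "u \<in> cell u q d" using translate_cell[of "translate i u" u q j "-i"] by (simp add: d_def)
  then have win: "\<exists>m. \<forall>s. \<bar>s\<bar> \<le> N \<longrightarrow> u s = u (s + (d + int q * m))" for N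
    using cellD[of u u q d N] by (simp add: agree_def translate_def)
  have step: "k - d \<in> per u q \<and> u (k - d) = u k" if "k \<in> per u q" for k
  proof -
    have "u (k - d + int q * r) = u k" for r
    proof -
      obtain m where "u (k - d + int q * r) = u (k - d + int q * r + (d + int q * m))"
        using win[of "\<bar>k - d + int q * r\<bar>"] by auto
      also have "\<dots> = u k" by (rule perD[OF that]) (simp add: algebra_simps flip: distrib_left)
      finally show ?thesis .
    qed
    from this this[of 0] show ?thesis by (simp add: per_def)
  qed
  have steps: "k - int a * d \<in> per u q \<and> u (k - int a * d) = u k" if "k \<in> per u q" for k a
  proof (induction a)
    case (Suc a)
    then show ?case using step[of "k - int a * d"] by (simp add: algebra_simps)
  qed (use that in simp)
  define g where "g = nat (gcd d (int q))"
  have q1: "q \<ge> 1" using p_ge1 by (simp add: q_def)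
  then have g1: "g \<ge> 1" "int g = gcd d (int q)" by (auto simp: g_def Suc_le_eq)
  have "per u q \<subseteq> per u g"
  proof
    fix k assume k: "k \<in> per u q"
    have "u (k + int g * m) = u k" for m
    proof -
      obtain a0 b0 where ab: "a0 * d + b0 * int q = int g" using bezout_int[of d "int q"] g1 by auto
      \<comment> \<open>The invariance is available for nonnegative multiples of \<open>-d\<close>
        only. The Bezout coefficient may have either sign, so it is replaced by its residue modulo
        \<open>q\<close>, which changes the position by a multiple of \<open>q\<close>.\<close>
      define a where "a = nat ((- a0 * m) mod int q)"
      have a: "int a = (- a0 * m) mod int q" using q1 by (simp add: a_def)
      have "int q dvd - a0 * m - int a" by (simp add: a)
      then have "int q dvd (- a0 * m - int a) * d" by simp
      moreover have "int q dvd b0 * m * int q" by simp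
      ultimately have *: "int q dvd b0 * m * int q - (- a0 * m - int a) * d" by (rule dvd_diff[rotated])
      have "b0 * m * int q - (- a0 * m - int a) * d = (a0 * d + b0 * int q) * m + int a * d"
        by (simp add: algebra_simps)
      also have "\<dots> = k + int g * m - (k - int a * d)" by (simp add: ab)
      finally have "int q dvd k + int g * m - (k - int a * d)" using * by simp
      then have "u (k + int g * m) = u (k - int a * d)" using steps[OF k, of a] perD by blast
      then show ?thesis using steps[OF k, of a] by simp
    qed
    then show "k \<in> per u g" by (simp add: per_def)
  qed
  moreover have gq: "g dvd q" using g1 by (metis gcd_dvd2 of_nat_dvd_iff)
  ultimately have "per u g = per u q" using per_mono by blast
  then have "\<not> g < q" using p_essential[of k] g1 by (auto simp: essential_period_def q_def)
  then have "g = q" using gq q1 dvd_imp_le[OF gq] by simp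
  then show ?thesis using g1 by (metis gcd_dvd1 d_def q_def)
qed

text \<open>The fibre of the factor map onto the odometer is a single point over the orbit of \<open>u\<close>.\<close>

lemma eq_translate_if_cell:
  assumes "\<And>k. k \<ge> K \<Longrightarrow> x \<in> cell u (p k) j"
  shows "x = translate j u"
proof
  fix i
  obtain k where k: "k \<ge> K" "i + j \<in> per u (p k)" using finite_subset_per[of "{i + j}" K] by auto
  obtain m where "agree \<bar>i\<bar> x (translate (j + int (p k) * m) u)" using cellD[OF assms[OF k(1)]] by blast
  then have "x i = u (i + (j + int (p k) * m))" by (simp add: agree_def translate_def)
  also have "\<dots> = u (i + j)" by (rule perD[OF k(2)]) simp
  finally show "x i = translate j u i" by (simp add: translate_def)
qed

text \<open>The values increase under divisibility and are at most \<open>n\<close>, so an index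
  attaining the maximum works.\<close>

lemma gcd_stable: "\<exists>K. \<forall>l\<ge>K. gcd n (p l) = gcd n (p K)" if "n \<ge> 1"
proof -
  define G where "G = range (\<lambda>l. gcd n (p l))"
  have "finite G" unfolding G_def
    by (rule finite_subset[of _ "{..n}"]) (use that in \<open>auto intro: dvd_imp_le\<close>)
  then have "Max G \<in> G" by (intro Max_in) (auto simp: G_def)
  then obtain K where K: "Max G = gcd n (p K)" by (auto simp: G_def)
  have "gcd n (p l) = gcd n (p K)" if "l \<ge> K" for l
  proof -
    have "gcd n (p K) dvd gcd n (p l)" using p_dvd[OF that] by (meson dvd_trans gcd_dvd1 gcd_dvd2 gcd_greatest)
    moreover have "gcd n (p l) \<le> gcd n (p K)" using \<open>finite G\<close> unfolding K[symmetric] by (auto simp: G_def)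
    moreover have "gcd n (p l) > 0" using \<open>n \<ge> 1\<close> by simp
    ultimately show ?thesis by (metis dvd_imp_le le_antisym)
  qed
  then show ?thesis by blast
qed

end

section \<open>Block coding of a component\<close>

text \<open>The natural alphabet consists of words of length \<open>q\<close> and changes with
  \<open>q\<close>. Coding words in \<open>nat\<close> gives all stages of the direct limit one
  type.\<close>

definition block :: "nat \<Rightarrow> (int \<Rightarrow> 'a::countable) \<Rightarrow> int \<Rightarrow> nat" where
  "block q x = (\<lambda>m. to_nat (map (\<lambda>i. x (m * int q + int i)) [0..<q]))"

definition unblock :: "nat \<Rightarrow> (int \<Rightarrow> nat) \<Rightarrow> int \<Rightarrow> 'a::countable" where
  "unblock q y = (\<lambda>i. (from_nat (y (i div int q)) :: 'a list) ! nat (i mod int q))"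

lemma block_eq_iff: "block q x m = block q y n \<longleftrightarrow> (\<forall>i<q. x (m * int q + int i) = y (n * int q + int i))"
  by (auto simp: block_def)

lemma unblock_block:
  assumes "q \<ge> 1"
  shows "unblock q (block q x) = x"
proof
  fix i
  have "nat (i mod int q) < q" using assms by (simp add: nat_less_iff)
  then show "unblock q (block q x) i = x i"
    using assms by (simp add: unblock_def block_def)
qed

lemma block_unblock:
  assumes "q \<ge> 1" and "\<And>m. \<exists>w :: 'a::countable list. length w = q \<and> y m = to_nat w"
  shows "block q (unblock q y :: int \<Rightarrow> 'a) = y"
proof
  fix m
  obtain w :: "'a list" where w: "length w = q" "y m = to_nat w" using assms(2) by blast
  have "map (\<lambda>i. unblock q y (m * int q + int i)) [0..<q] = w"
    using w assms(1) by (intro nth_equalityI) (auto simp: unblock_def)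
  then show "block q (unblock q y :: int \<Rightarrow> 'a) m = y m" by (simp add: block_def w)
qed

lemma block_translate: "block q (translate (int q * n) x) = translate n (block q x)"
  by (rule ext) (simp add: block_def translate_def algebra_simps)

lemma unblock_translate:
  assumes "q \<ge> 1"
  shows "unblock q (translate n y) = translate (int q * n) (unblock q y)"
  using assms by (auto simp: unblock_def translate_def add.commute)

text \<open>The blocks with index at most \<open>N\<close> in absolute value reach no further than
  \<open>q N + (q - 1)\<close>.\<close>

lemma agree_block:
  assumes "agree (int q * (N + 1)) x y"
  shows "agree N (block q x) (block q y)"
  unfolding agree_def block_eq_iff
proof (intro allI impI)
  fix m i assume m: "\<bar>m\<bar> \<le> N" and i: "i < q"
  have "\<bar>m * int q\<bar> \<le> N * int q" using m by (simp add: abs_mult mult_right_mono)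
  then have "\<bar>m * int q + int i\<bar> \<le> int q * (N + 1)" using i by (simp add: algebra_simps)
  then show "x (m * int q + int i) = y (m * int q + int i)" using assms unfolding agree_def by blast
qed

lemma agree_unblock:
  assumes "agree N x y" "q \<ge> 1"
  shows "agree N (unblock q x) (unblock q y)"
proof -
  \<comment> \<open>Floor division keeps a negative \<open>i\<close> between \<open>i\<close> and
    \<open>-1\<close>, so the same window suffices.\<close>
  have "\<bar>i div int q\<bar> \<le> \<bar>i\<bar>" for i
  proof (cases "i \<ge> 0")
    case True
    then show ?thesis
      using zdiv_mono2[of i 1 "int q"] assms(2) by (simp add: pos_imp_zdiv_nonneg_iff)
  next
    case False
    then show ?thesis
      using zdiv_mono2_neg[of i 1 "int q"] div_neg_pos_less0[of i "int q"] assms(2) by simp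
  qed
  then have "\<bar>i div int q\<bar> \<le> N" if "\<bar>i\<bar> \<le> N" for i using that order_trans by blast
  then show ?thesis using assms(1) by (auto simp: agree_def unblock_def)
qed

lemma block_in_subshift:
  assumes "x \<in> cell u q 0"
  shows "block q x \<in> subshift (block q u)"
  unfolding subshift_eq_cell[of _ 0]
proof (rule cellI)
  fix N
  obtain m where "agree (int q * (N + 1)) x (translate (0 + int q * m) u)" using cellD[OF assms] by blast
  then have "agree N (block q x) (translate m (block q u))" using agree_block[of q N x "translate (int q * m) u"] by (simp add: block_translate)
  then show "\<exists>m. agree N (block q x) (translate (0 + int 1 * m) (block q u))" by auto
qed

lemma unblock_in_cell:
  fixes u :: "int \<Rightarrow> 'a::countable"
  assumes "y \<in> subshift (block q u)" "q \<ge> 1"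
  shows "unblock q y \<in> cell u q 0"
proof (rule cellI)
  fix N
  obtain m where "agree N y (translate m (block q u))"
    using cellD[of y _ 1 0 N] assms(1) by (auto simp: subshift_eq_cell[of _ 0])
  then have "agree N (unblock q y) (unblock q (translate m (block q u)) :: int \<Rightarrow> 'a)"
    using assms(2) by (rule agree_unblock)
  then have "agree N (unblock q y) (translate (int q * m) u)"
    using assms(2) by (simp add: unblock_translate unblock_block)
  then show "\<exists>m. agree N (unblock q y) (translate (0 + int q * m) u)" by auto
qed

text \<open>Every symbol of \<open>y\<close> occurs in \<open>block q u\<close>, so it codes a word
  of length \<open>q\<close>; a number that codes no such word would not survive
  \<open>unblock\<close>.\<close>

lemma block_unblock_subshift:
  fixes u :: "int \<Rightarrow> 'a::countable"
  assumes "y \<in> subshift (block q u)" "q \<ge> 1"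
  shows "block q (unblock q y :: int \<Rightarrow> 'a) = y"
proof (rule block_unblock[OF assms(2)])
  fix m
  obtain n where "agree \<bar>m\<bar> y (translate n (block q u))"
    using cellD[of y _ 1 0 "\<bar>m\<bar>"] assms(1) by (auto simp: subshift_eq_cell[of _ 0])
  then have "y m = block q u (m + n)" by (simp add: agree_def translate_def)
  then show "\<exists>w :: 'a list. length w = q \<and> y m = to_nat w"
    by (intro exI[of _ "map (\<lambda>i. u ((m + n) * int q + int i)) [0..<q]"]) (simp add: block_def)
qed

section \<open>Maps commuting with a power of the shift\<close>

lemma commutes_translate_multiple:
  assumes "\<And>x. x \<in> A \<Longrightarrow> f (translate n x) = translate n (f x)" and "\<And>x k. x \<in> A \<Longrightarrow> translate k x \<in> A" and "x \<in> A"
  shows "f (translate (n * m) x) = translate (n * m) (f x)"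
proof -
  have nat: "f (translate (n * int m) x) = translate (n * int m) (f x)" if "x \<in> A" for m x
  proof (induction m)
    case (Suc m)
    have "f (translate n (translate (n * int m) x)) = translate n (f (translate (n * int m) x))" by (intro assms(1,2) that)
    then show ?case using Suc by (simp add: algebra_simps)
  qed simp
  show ?thesis
  proof (cases "m \<ge> 0")
    case True
    then show ?thesis using nat[OF assms(3), of "nat m"] by simp
  next
    case False
    \<comment> \<open>A negative multiple needs no inverse of \<open>f\<close>: the positive case is
      applied at the point \<open>translate (n * m) x\<close>.\<close>
    then have "f (translate (- (n * m)) (translate (n * m) x)) = translate (- (n * m)) (f (translate (n * m) x))"
      using nat[OF assms(2)[OF assms(3)], of "nat (- m)" "n * m"] by simp
    then have "translate (n * m) (f x) = translate (n * m) (translate (- (n * m)) (f (translate (n * m) x)))" by simp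
    then show ?thesis by simp
  qed
qed

lemma shift_funpow_in: "shift ^^ n \<in> topspace (subshift_top u) \<rightarrow> topspace (subshift_top u)"
  by (auto simp: shift_funpow intro: translate_subshift)

lemma aut_group_subshift_mono:
  assumes f: "f \<in> carrier (aut_group (subshift_top u) (shift ^^ a))" and ab: "a dvd b"
  shows "f \<in> carrier (aut_group (subshift_top u) (shift ^^ b))"
proof -
  obtain c where "b = a * c" using ab by blast
  moreover have "f (translate (int a * int c) x) = translate (int a * int c) (f x)" if "x \<in> subshift u" for x
    using f that by (intro commutes_translate_multiple[of "subshift u"] translate_subshift)
      (auto simp: aut_group_def shift_funpow)
  ultimately show ?thesis using f by (simp add: aut_group_def shift_funpow)
qed

lemma continuous_map_subshift:
  "continuous_map (subshift_top u) (subshift_top v) g \<longleftrightarrow>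
    g \<in> subshift u \<rightarrow> subshift v \<and> (\<forall>x\<in>subshift u. \<forall>N. \<exists>M. \<forall>y\<in>subshift u. agree M x y \<longrightarrow> agree N (g x) (g y))"
  by (simp add: subshift_top_def continuous_map_full_shift_sub)

context toeplitz_structure
begin

text \<open>With \<open>d = gcd n (p K)\<close> for large \<open>K\<close>, the powers of \<open>\<sigma>^n\<close> are dense in those of \<open>\<sigma>^d\<close> on every level of the
  odometer. Hence \<open>f \<circ> \<sigma>^d\<close> and \<open>\<sigma>^d \<circ> f\<close> have the same image in the odometer; at a point \<open>x\<close> with \<open>f x\<close> in the
  orbit of \<open>u\<close> this determines the value, and the \<open>\<sigma>^n\<close>-orbit of \<open>x\<close> is dense in its component.\<close>

lemma aut_power_commutes_period:
  assumes f: "f \<in> carrier (aut_group (subshift_top u) (shift ^^ n))" and n: "n \<ge> 1"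
  shows "\<exists>k. f \<in> carrier (aut_group (subshift_top u) (shift ^^ p k))"
proof -
  let ?X = "subshift u"
  obtain g where fg: "homeomorphic_maps (subshift_top u) (subshift_top u) f g"
    and fT: "\<And>x. x \<in> ?X \<Longrightarrow> f (translate (int n) x) = translate (int n) (f x)"
    and gT: "\<And>x. x \<in> ?X \<Longrightarrow> g (translate (int n) x) = translate (int n) (g x)"
    by (rule aut_groupE[OF f shift_funpow_in]) (auto simp: shift_funpow)
  have fX: "f x \<in> ?X" and gX: "g x \<in> ?X" and gf: "g (f x) = x" and f_g: "f (g x) = x"
    if "x \<in> ?X" for x
    using fg that by (auto simp: homeomorphic_maps_def continuous_map_def)
  have cf: "\<exists>M. \<forall>y\<in>?X. agree M x y \<longrightarrow> agree N (f x) (f y)"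
    and cg: "\<exists>M. \<forall>y\<in>?X. agree M x y \<longrightarrow> agree N (g x) (g y)" if "x \<in> ?X" for x N
    using fg that unfolding homeomorphic_maps_def continuous_map_subshift by blast+
  have fTm: "f (translate (int n * m) x) = translate (int n * m) (f x)"
    and gTm: "g (translate (int n * m) x) = translate (int n * m) (g x)" if "x \<in> ?X" for x m
    by (rule commutes_translate_multiple[of ?X]; use fT gT that translate_subshift in blast)+
  obtain K where K: "\<And>l. l \<ge> K \<Longrightarrow> gcd n (p l) = gcd n (p K)" using gcd_stable[OF n] by blast
  define d where "d = gcd n (p K)"
  have gcd_d: "gcd (int n) (int (p l)) dvd int d" if "l \<ge> K" for l
    using K[OF that] by (simp only: d_def gcd_int_int_eq dvd_refl)
  have d: "d \<ge> 1" "d dvd n" "d dvd p K" using n by (auto simp: d_def Suc_le_eq)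
  have commutes: "f (translate (int d) z) = translate (int d) (f z)" if z: "z \<in> ?X" for z
  proof -
    \<comment> \<open>With \<open>q = d\<close> and \<open>e = 0\<close>:
      \<open>\<sigma>^n\<close>-orbits are dense in the cells modulo \<open>d\<close>.\<close>
    have dense: "\<exists>m. agree N b (translate (int n * m) a)" if "a \<in> cell u d j" "b \<in> cell u d j" for a b j N
      using orbit_approximates[of K n "int d" d 0 a j b N] gcd_d d n that by auto
    obtain i where i: "f z \<in> cell u d (int i)" using cell_cover[OF fX[OF z] d(1)] by blast
    define c where "c = translate (int i) u"
    have cX: "c \<in> ?X" using cell_subset_subshift[OF translate_in_cell] by (simp add: c_def)
    define x where "x = g c"
    have x: "x \<in> ?X" and fx: "f x = c" using gX[OF cX] f_g[OF cX] by (auto simp: x_def)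
    obtain j where j: "z \<in> cell u d j" using cell_cover[OF z d(1)] by blast
    \<comment> \<open>The \<open>\<sigma>^n\<close>-orbit of \<open>f z\<close> accumulates at
      \<open>c\<close>, so applying \<open>g\<close> shows that the orbit of \<open>z\<close>
      accumulates at \<open>x\<close>. It stays in the closed cell of \<open>z\<close> because
      \<open>d\<close> divides \<open>n\<close>.\<close>
    have xj: "x \<in> cell u d j"
    proof (rule cell_closed)
      fix N
      obtain M where M: "\<forall>y\<in>?X. agree M c y \<longrightarrow> agree N x (g y)" using cg[OF cX] by (auto simp: x_def)
      obtain m where m: "agree M c (translate (int n * m) (f z))"
        using dense[OF i translate_in_cell] by (auto simp: c_def)
      have "agree N x (translate (int n * m) z)"
        using M m gTm[OF fX[OF z]] gf[OF z] translate_subshift[OF fX[OF z]] by metis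
      moreover have "translate (int n * m) z \<in> cell u d (j + int n * m)" by (rule translate_cell[OF j])
      moreover have "cell u d (j + int n * m) = cell u d j"
        by (rule cell_cong) (use d(2) in \<open>auto simp: dvd_diff_commute\<close>)
      ultimately show "\<exists>y\<in>cell u d j. agree N x y" by auto
    qed
    \<comment> \<open>At each level \<open>k \<ge> K\<close> the point \<open>\<sigma>^d x\<close>
      is approximated by \<open>\<sigma>^(n m) x\<close> with \<open>n m\<close> congruent to
      \<open>d\<close> modulo \<open>p k\<close>. Its image under \<open>f\<close> is
      \<open>\<sigma>^(n m) c\<close>, in the cell of \<open>i + d\<close>; all levels together
      leave one point.\<close>
    have "f (translate (int d) x) = translate (int i + int d) u"
    proof (rule eq_translate_if_cell[of K])
      fix k assume k: "K \<le> k"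
      obtain j' where j': "x \<in> cell u (p k) j'" using cell_cover[OF x p_ge1] by blast
      have dk: "d dvd p k" using d(3) p_dvd[OF k] dvd_trans by blast
      show "f (translate (int d) x) \<in> cell u (p k) (int i + int d)"
      proof (rule cell_closed)
        fix N
        obtain M where M: "\<forall>y\<in>?X. agree M (translate (int d) x) y \<longrightarrow> agree N (f (translate (int d) x)) (f y)"
          using cf[OF translate_subshift[OF x]] by blast
        obtain m where m: "agree M (translate (int d) x) (translate (int n * m) x)" "int (p k) dvd int n * m - int d"
          using orbit_approximates[of k n "int d" "p k" "int d" x j' "translate (int d) x" M]
            gcd_d k dk n j' translate_cell[OF j'] by auto
        have "agree N (f (translate (int d) x)) (translate (int n * m) c)"
          using M m(1) fTm[OF x] translate_subshift[OF x] by (metis fx)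
        moreover have "translate (int n * m) c \<in> cell u (p k) (int n * m + int i)"
          using translate_in_cell by (auto simp: c_def)
        moreover have "cell u (p k) (int n * m + int i) = cell u (p k) (int i + int d)"
          by (rule cell_cong) (use m(2) in \<open>simp add: dvd_diff_commute\<close>)
        ultimately show "\<exists>y\<in>cell u (p k) (int i + int d). agree N (f (translate (int d) x)) y" by auto
      qed
    qed
    then have fx_d: "f (translate (int d) x) = translate (int d) (f x)" by (simp add: fx c_def add.commute)
    \<comment> \<open>The identity at \<open>x\<close> holds along its whole
      \<open>\<sigma>^n\<close>-orbit, which comes arbitrarily close to \<open>z\<close>, and both
      sides are continuous.\<close>
    show ?thesis
    proof (rule eq_if_agree)
      fix N
      obtain M1 where M1: "\<forall>y\<in>?X. agree M1 z y \<longrightarrow> agree (N + \<bar>int d\<bar>) (f z) (f y)" using cf[OF z] by blast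
      obtain M2 where M2: "\<forall>y\<in>?X. agree M2 (translate (int d) z) y \<longrightarrow> agree N (f (translate (int d) z)) (f y)"
        using cf[OF translate_subshift[OF z]] by blast
      obtain m where m: "agree (max M1 (M2 + \<bar>int d\<bar>)) z (translate (int n * m) x)" using dense[OF xj j] by blast
      define w where "w = translate (int n * m) x"
      have w: "w \<in> ?X" using translate_subshift[OF x] by (simp add: w_def)
      have "agree M1 z w" "agree (M2 + \<bar>int d\<bar>) z w"
        using agree_mono[OF m] by (simp_all add: w_def)
      then have 1: "agree (N + \<bar>int d\<bar>) (f z) (f w)" and 2: "agree M2 (translate (int d) z) (translate (int d) w)"
        using M1[rule_format, OF w] agree_translate by iprover+
      note agree_translate[OF 1] and M2[rule_format, OF translate_subshift[OF w] 2]
      moreover have "f (translate (int d) w) = translate (int d) (f w)"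
      proof -
        have "f (translate (int d) w) = f (translate (int n * m) (translate (int d) x))" by (simp add: w_def add.commute)
        also have "\<dots> = translate (int n * m) (translate (int d) (f x))" using fTm[OF translate_subshift[OF x]] fx_d by metis
        also have "\<dots> = translate (int d) (translate (int n * m) (f x))" by (simp add: add.commute)
        also have "\<dots> = translate (int d) (f w)" using fTm[OF x] by (simp add: w_def)
        finally show ?thesis .
      qed
      ultimately show "agree N (f (translate (int d) z)) (translate (int d) (f z))" using agree_trans agree_sym by metis
    qed
  qed
  have "f \<in> carrier (aut_group (subshift_top u) (shift ^^ d))"
    using f commutes by (simp add: aut_group_def shift_funpow)
  then show ?thesis using aut_group_subshift_mono d(3) by blast
qed

section \<open>The subshift as a tower over its block coding\<close>

definition level :: "nat \<Rightarrow> (int \<Rightarrow> 'a) \<Rightarrow> nat" where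
  "level q x = (SOME c. c < q \<and> x \<in> cell u q (int c))"

lemma level: "x \<in> subshift u \<Longrightarrow> level (p k) x < p k \<and> x \<in> cell u (p k) (int (level (p k) x))"
  unfolding level_def by (rule someI_ex) (rule cell_cover[OF _ p_ge1])

lemma level_unique:
  assumes "x \<in> cell u (p k) (int c)" "c < p k"
  shows "level (p k) x = c"
proof -
  have "int (p k) dvd int (level (p k) x) - int c"
    using level[OF cell_subset_subshift[OF assms(1)]] cell_disjoint assms(1) by blast
  moreover have "level (p k) x < p k" using level[OF cell_subset_subshift[OF assms(1)]] by blast
  ultimately show ?thesis using assms(2) by (metis mod_eq_dvd_iff mod_less of_nat_mod of_nat_eq_iff)
qed

text \<open>Cells are closed and finite in number, so one window separates \<open>x\<close> from
  every cell that does not contain it.\<close>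

lemma level_locally_constant:
  assumes x: "x \<in> subshift u"
  shows "\<exists>N. \<forall>y\<in>subshift u. agree N x y \<longrightarrow> level (p k) y = level (p k) x"
proof -
  have "\<exists>N. \<forall>y\<in>cell u (p k) (int c). \<not> agree N x y" if "c < p k" "c \<noteq> level (p k) x" for c
    using cell_closed[of u "p k" "int c" x] level_unique that by blast
  then obtain N where N: "\<And>c y. c < p k \<Longrightarrow> c \<noteq> level (p k) x \<Longrightarrow> y \<in> cell u (p k) (int c) \<Longrightarrow> \<not> agree (N c) x y"
    by metis
  define L where "L = Max (N ` {0..<p k})"
  have "level (p k) y = level (p k) x" if y: "y \<in> subshift u" "agree L x y" for y
  proof (rule ccontr)
    assume ne: "level (p k) y \<noteq> level (p k) x"
    have "N (level (p k) y) \<le> L" unfolding L_def using level[OF y(1)] by (intro Max_ge) auto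
    then show False using N[OF _ ne] level[OF y(1)] agree_mono[OF y(2)] by blast
  qed
  then show ?thesis by blast
qed

text \<open>Translating back by its level moves a point into the cell of residue \<open>0\<close>,
  where the block boundaries are at multiples of \<open>p k\<close> and the block code is a
  conjugacy from \<open>\<sigma>^(p k)\<close> to the shift.\<close>

lemma tower_subshift:
  "tower (subshift_top u) (subshift_top (block (p k) u)) (shift ^^ p k) shift (p k) (level (p k))
    (\<lambda>x. block (p k) (translate (- int (level (p k) x)) x)) (\<lambda>c y. translate (int c) (unblock (p k) y))"
proof -
  define q where "q = p k"
  have q1: "q \<ge> 1" using p_ge1 by (simp add: q_def)
  define r where "r x = block q (translate (- int (level q x)) x)" for x
  define s :: "nat \<Rightarrow> (int \<Rightarrow> nat) \<Rightarrow> int \<Rightarrow> 'a" where "s c y = translate (int c) (unblock q y)" for c y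
  note level' = level[of _ k, folded q_def] and level_unique' = level_unique[of _ k, folded q_def]
  have s_cell: "s c y \<in> cell u q (int c)" if "y \<in> subshift (block q u)" for c y
    using translate_cell[OF unblock_in_cell[OF that q1], of "int c"] by (simp add: s_def)
  have level_s: "level q (s c y) = c" if "c < q" "y \<in> subshift (block q u)" for c y
    using level_unique'[OF s_cell] that by simp
  have base_cell: "translate (- int (level q x)) x \<in> cell u q 0" if "x \<in> subshift u" for x
    using translate_cell[of x u q "int (level q x)" "- int (level q x)"] level'[OF that] by simp
  have "tower (subshift_top u) (subshift_top (block q u)) (shift ^^ q) shift q (level q) r s"
  proof
    show "level q x < q" if "x \<in> topspace (subshift_top u)" for x using that level' by simp
    show "openin (subshift_top u) {x \<in> topspace (subshift_top u). level q x = c}" for c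
      unfolding subshift_top_def openin_full_shift_sub
      using level_locally_constant[of _ k, folded q_def] by fastforce
    show "continuous_map (subshift_top u) (subshift_top (block q u)) r"
      unfolding continuous_map_subshift
    proof (intro conjI ballI allI)
      show "r \<in> subshift u \<rightarrow> subshift (block q u)"
        by (auto simp: r_def intro!: block_in_subshift[OF base_cell])
      fix x N assume x: "x \<in> subshift u"
      obtain L where L: "\<forall>y\<in>subshift u. agree L x y \<longrightarrow> level q y = level q x"
        using level_locally_constant[OF x, of k] by (auto simp: q_def)
      let ?M = "max L (int q * (N + 1) + \<bar>- int (level q x)\<bar>)"
      have "agree N (r x) (r y)" if y: "y \<in> subshift u" "agree ?M x y" for y
      proof -
        have "level q y = level q x" using L y agree_mono by (metis max.cobounded1)
        moreover have "agree (int q * (N + 1) + \<bar>- int (level q x)\<bar>) x y"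
          using agree_mono[OF y(2)] by simp
        ultimately show ?thesis unfolding r_def by (metis agree_block agree_translate)
      qed
      then show "\<exists>M. \<forall>y\<in>subshift u. agree M x y \<longrightarrow> agree N (r x) (r y)" by blast
    qed
    show "continuous_map (subshift_top (block q u)) (subshift_top u) (s c)" for c
      unfolding continuous_map_subshift
    proof (intro conjI ballI allI)
      show "s c \<in> subshift (block q u) \<rightarrow> subshift u"
        using s_cell cell_subset_subshift by blast
      fix x N
      have "agree N (s c x) (s c y)" if "agree (N + \<bar>int c\<bar>) x y" for y
        unfolding s_def using agree_translate agree_unblock[OF that q1] by blast
      then show "\<exists>M. \<forall>y\<in>subshift (block q u). agree M x y \<longrightarrow> agree N (s c x) (s c y)" by blast
    qed
    show "level q (s c y) = c" if "c < q" "y \<in> topspace (subshift_top (block q u))" for c y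
      using level_s that by simp
    show "r (s c y) = y" if "c < q" "y \<in> topspace (subshift_top (block q u))" for c y
      using level_s[OF that(1)] that(2) q1 by (simp add: r_def) (simp add: s_def block_unblock_subshift)
    show "s (level q x) (r x) = x" if "x \<in> topspace (subshift_top u)" for x
      using q1 by (simp add: s_def r_def unblock_block)
    show "shift y \<in> topspace (subshift_top (block q u))" if "y \<in> topspace (subshift_top (block q u))" for y
      using that translate_subshift by (simp add: shift_eq_translate)
    show "s c (shift y) = (shift ^^ q) (s c y)" for c y
      using q1 unfolding shift_funpow by (simp add: s_def shift_eq_translate unblock_translate add.commute)
    show "topspace (subshift_top (block q u)) \<noteq> {}"
      using block_in_subshift[of u u q] translate_in_cell[of 0 u q] by auto
    fix F c y y'
    assume F: "continuous_map (subshift_top u) (subshift_top u) F"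
      and FT: "\<And>x. x \<in> topspace (subshift_top u) \<Longrightarrow> F ((shift ^^ q) x) = (shift ^^ q) (F x)"
      and c: "c < q" and y: "y \<in> topspace (subshift_top (block q u))"
      and y': "y' \<in> topspace (subshift_top (block q u))"
    define x where "x = s c y"
    define x' where "x' = s c y'"
    have x: "x \<in> cell u q (int c)" "x \<in> subshift u" and x': "x' \<in> cell u q (int c)" "x' \<in> subshift u"
      using y y' by (auto simp: x_def x'_def intro: s_cell cell_subset_subshift[OF s_cell])
    have Fx: "F x \<in> subshift u" using F x(2) by (auto simp: continuous_map_subshift)
    define e where "e = level q (F x)"
    have e: "e < q" "F x \<in> cell u q (int e)" using level'[OF Fx] by (auto simp: e_def)
    \<comment> \<open>Here \<open>level_transitive\<close> follows from minimality: \<open>F\<close>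
      keeps the \<open>\<sigma>^q\<close>-orbit of \<open>x\<close> in the closed cell of
      \<open>F x\<close>, and that orbit accumulates at \<open>x'\<close>.\<close>
    have "F x' \<in> cell u q (int e)"
    proof (rule cell_closed)
      fix N
      obtain M where M: "\<forall>y\<in>subshift u. agree M x' y \<longrightarrow> agree N (F x') (F y)"
        using F x'(2) unfolding continuous_map_subshift by blast
      obtain m where m: "agree M x' (translate (int q * m) x)"
        using cell_orbit_dense[of x k "int c" x' M] x x' by (auto simp: q_def)
      have "F (translate (int q * m) x) = translate (int q * m) (F x)"
        using FT x(2) by (intro commutes_translate_multiple[of "subshift u"] translate_subshift) (auto simp: shift_funpow)
      then have "agree N (F x') (translate (int q * m) (F x))" using M m translate_subshift[OF x(2)] by metis
      moreover have "translate (int q * m) (F x) \<in> cell u q (int e + int q * m)" using translate_cell[OF e(2)] .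
      moreover have "cell u q (int e + int q * m) = cell u q (int e)" by (rule cell_cong) simp
      ultimately show "\<exists>y\<in>cell u q (int e). agree N (F x') y" by auto
    qed
    from level_unique'[OF this e(1)] show "level q (F (s c y)) = level q (F (s c y'))"
      by (simp add: e_def x_def x'_def)
  qed
  then show ?thesis unfolding q_def r_def[abs_def] s_def[abs_def] .
qed

text \<open>A period \<open>c\<close> of the coding would give \<open>u\<close> the period
  \<open>q c\<close>. Conversely, a block covers finitely many positions of \<open>u\<close>, which
  share some period \<open>p l\<close>; displacing the block index by a multiple of
  \<open>p l\<close> moves them by a multiple of \<open>p l\<close>.\<close>

lemma toeplitz_block: "toeplitz (block (p k) u)"
  unfolding toeplitz_def
proof (intro conjI allI)
  define q where "q = p k"
  have q1: "q \<ge> 1" using p_ge1 by (simp add: q_def)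
  have "periodic_seq u" if "c \<ge> 1" "\<And>i. block q u (i + c) = block q u i" for c
  proof -
    have "translate c (block q u) = block q u" using that(2) by (simp add: translate_def)
    then have "block q (translate (int q * c) u) = block q u" by (simp add: block_translate)
    then have "translate (int q * c) u = u" using unblock_block[OF q1] by metis
    then have "u (i + int q * c) = u i" for i by (metis translate_apply)
    moreover have "int q * c \<ge> 1" using q1 that(1) by (smt (verit) mult_pos_pos of_nat_1 of_nat_mono)
    ultimately show ?thesis unfolding periodic_seq_def by blast
  qed
  then show "\<not> periodic_seq (block (p k) u)"
    using toep unfolding periodic_seq_def[of "block (p k) u"] q_def toeplitz_def by blast
  fix n
  obtain l where l: "(\<lambda>i. n * int q + int i) ` {0..<q} \<subseteq> per u (p l)"
    using finite_subset_per[of "(\<lambda>i. n * int q + int i) ` {0..<q}" 0] by auto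
  have "block q u n = block q u (n + j * int (p l))" for j
    unfolding block_eq_iff
  proof (intro allI impI)
    fix i assume "i < q"
    then have "n * int q + int i \<in> per u (p l)" using l by auto
    from perD[OF this, of "(n + j * int (p l)) * int q + int i"]
    show "u (n * int q + int i) = u ((n + j * int (p l)) * int q + int i)"
      by (simp add: algebra_simps)
  qed
  then show "\<exists>m\<ge>1. \<forall>j. block (p k) u n = block (p k) u (n + j * m)"
    using p_ge1[of l] unfolding q_def by (intro exI[of _ "int (p l)"]) auto
qed

end

text \<open>The symbols are of type \<open>nat\<close>, so this is what makes the coding a sequence
  over a finite alphabet.\<close>

lemma finite_range_block:
  fixes u :: "int \<Rightarrow> 'a::finite"
  shows "finite (range (block q u))"
proof (rule finite_subset)
  show "range (block q u) \<subseteq> to_nat ` {w :: 'a list. set w \<subseteq> UNIV \<and> length w = q}"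
    by (auto simp: block_def)
  show "finite (to_nat ` {w :: 'a list. set w \<subseteq> UNIV \<and> length w = q})"
    by (intro finite_imageI finite_lists_length_eq) simp
qed

theorem theorem1p2:
  fixes u :: "int \<Rightarrow> 'a::finite" and p :: "nat \<Rightarrow> nat"
  assumes "toeplitz u" and "period_structure u p"
  shows "\<exists>(t :: nat \<Rightarrow> int \<Rightarrow> nat) (k :: nat \<Rightarrow> nat) \<phi>.
           (\<forall>j. toeplitz (t j) \<and> finite (range (t j))) \<and>
           (\<forall>j. \<phi> j \<in> hom (power_rtimes_sym (aut_subshift (t j)) (p (k j)))
                          (power_rtimes_sym (aut_subshift (t (Suc j))) (p (k (Suc j)))) \<and>
                inj_on (\<phi> j) (carrier (power_rtimes_sym (aut_subshift (t j)) (p (k j))))) \<and>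
           stab_aut_subshift u \<cong>
             dirlim (\<lambda>j. power_rtimes_sym (aut_subshift (t j)) (p (k j))) \<phi>"
proof -
  interpret toeplitz_structure u p using assms by unfold_locales
  \<comment> \<open>Every term of the period structure is used, so the index map \<open>k\<close> of
    the statement is the identity.\<close>
  define G where "G j = power_rtimes_sym (aut_subshift (block (p j) u)) (p j)" for j
  define \<psi> where "\<psi> j = tower.glue (subshift_top u) (level (p j))
    (\<lambda>x. block (p j) (translate (- int (level (p j) x)) x)) (\<lambda>c y. translate (int c) (unblock (p j) y))" for j
  note tower = tower_subshift
  have bij: "bij_betw (\<psi> j) (carrier (G j)) (carrier (aut_group (subshift_top u) (shift ^^ p j)))" for j
    using tower.bij_betw_glue[OF tower, of j] by (simp add: \<psi>_def G_def aut_subshift_def)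
  have sub: "carrier (aut_group (subshift_top u) (shift ^^ p j)) \<subseteq> carrier (stab_aut_subshift u)" for j
    using p_ge1[of j] unfolding stab_aut_subshift_def stab_aut_group_def by auto
  have img: "\<psi> j ` carrier (G j) = carrier (aut_group (subshift_top u) (shift ^^ p j))" for j
    using bij by (simp add: bij_betw_def)
  have closed: "g \<otimes>\<^bsub>G j\<^esub> h \<in> carrier (G j)" if "g \<in> carrier (G j)" "h \<in> carrier (G j)" for j g h
    unfolding G_def
  proof (rule power_rtimes_sym_mult_closed)
    show "a \<otimes>\<^bsub>aut_subshift (block (p j) u)\<^esub> b \<in> carrier (aut_subshift (block (p j) u))"
      if "a \<in> carrier (aut_subshift (block (p j) u))" "b \<in> carrier (aut_subshift (block (p j) u))" for a b
      using that shift_funpow_in[of 1] unfolding aut_subshift_def by (intro aut_group_mult_closed) auto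
  qed (use that in \<open>auto simp: G_def\<close>)
  have hom: "\<psi> j \<in> hom (G j) (stab_aut_subshift u)" for j
  proof (rule homI)
    show "\<psi> j g \<in> carrier (stab_aut_subshift u)" if "g \<in> carrier (G j)" for g
      using img[of j] sub[of j] that by blast
    show "\<psi> j (g \<otimes>\<^bsub>G j\<^esub> h) = \<psi> j g \<otimes>\<^bsub>stab_aut_subshift u\<^esub> \<psi> j h"
      if "g \<in> carrier (G j)" "h \<in> carrier (G j)" for g h
      using tower.glue_mult[OF tower, of g j h] that
      by (simp add: \<psi>_def G_def aut_subshift_def stab_aut_subshift_def stab_aut_group_def)
  qed
  have mono: "\<psi> j ` carrier (G j) \<subseteq> \<psi> (Suc j) ` carrier (G (Suc j))" for j
    unfolding img using aut_group_subshift_mono p_dvd_Suc by blast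
  have cover: "carrier (stab_aut_subshift u) = (\<Union>j. \<psi> j ` carrier (G j))"
    unfolding img
  proof
    show "carrier (stab_aut_subshift u) \<subseteq> (\<Union>j. carrier (aut_group (subshift_top u) (shift ^^ p j)))"
      using aut_power_commutes_period by (auto simp: stab_aut_subshift_def stab_aut_group_def)
  qed (use sub in blast)
  have inj: "inj_on (\<psi> j) (carrier (G j))" for j using bij by (simp add: bij_betw_def)
  obtain \<phi> where "\<And>j. \<phi> j \<in> hom (G j) (G (Suc j)) \<and> inj_on (\<phi> j) (carrier (G j))"
    "stab_aut_subshift u \<cong> dirlim G \<phi>"
    using iso_dirlim_exhaustion[of G \<psi>, OF closed hom inj mono cover] by blast
  then show ?thesis
    using toeplitz_block finite_range_block[of _ u] unfolding G_def[abs_def]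
    by (intro exI[of _ "\<lambda>j. block (p j) u"] exI[of _ "\<lambda>j. j"] exI[of _ \<phi>] conjI allI) blast+
qed

end
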